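(* Let $a\in L^1(I)$. For every $\lambda<\lambda_0^N$ and all $(t,s)\in(0,1)\times(0,1)$, $$G_N[\lambda](t,s)<G_D[\lambda](t,s)<0.$$
   Context: $I=[0,1]$, $a\in L^1(I)$ is real-valued, $\lambda\in\mathbb{R}$, and $L[\lambda]u(t)=u''(t)+(a(t)+\lambda)u(t)$. $W^{2,1}(I)=\{u\in C(I):u'\in AC(I)\}$, where $AC(I)$ is the set of absolutely continuous functions on $I$. $X_D=\{u\in W^{2,1}(I):u(0)=u(1)=0\}$ (Dirichlet) and $X_N=\{u\in W^{2,1}(I):u'(0)=u'(1)=0\}$ (Neumann). $L[\lambda]$ is nonresonant in $X$ if $u=0$ is the only $u\in X$ with $L[\lambda]u=0$ a.e. on $I$. In that case, for every $\sigma\in L^1(I)$ the problem $L[\lambda]u=\sigma$ a.e. on $I$, $u\in X$, has a unique solution, given by $u(t)=\int_0^1G(t,s)\sigma(s)\,ds$, where the continuous function $G:I\times I\to\mathbb{R}$ is the Green's function; it is denoted $G_D[\lambda]$ for $X=X_D$ and $G_N[\lambda]$ for $X=X_N$. $\lambda_0^N$ and $\lambda_0^D$ denote the first (smallest) eigenvalues of the Neumann and Dirichlet problems, i.e. the smallest $\lambda$ for which $L[\lambda]u=0$ a.e. has a nontrivial solution in $X_N$, respectively $X_D$. It is known that $\lambda_0^N<\lambda_0^D$, so both Green's functions exist for $\lambda<\lambda_0^N$. *)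

theory Defs
  imports "HOL-Analysis.Analysis"
begin

text \<open>Functions on the unit interval are represented by total functions on the reals, of which only
  the values on \<open>I\<close> matter.\<close>

abbreviation I :: "real set" where
  "I \<equiv> {0..1}"

text \<open>A pair \<open>(x, y)\<close> in \<open>P\<close> stands for the interval from \<open>x\<close> to \<open>y\<close>.\<close>

definition absolutely_continuous_on :: "real set \<Rightarrow> (real \<Rightarrow> real) \<Rightarrow> bool" where
  "absolutely_continuous_on S f \<longleftrightarrow>
    (\<forall>\<epsilon>>0. \<exists>\<delta>>0. \<forall>P :: (real \<times> real) set.
      finite P \<longrightarrow>
      (\<forall>(x, y)\<in>P. x \<le> y \<and> {x..y} \<subseteq> S) \<longrightarrow>
      disjoint_family_on (\<lambda>(x, y). {x<..<y}) P \<longrightarrow>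
      (\<Sum>(x, y)\<in>P. y - x) < \<delta> \<longrightarrow>
      (\<Sum>(x, y)\<in>P. \<bar>f y - f x\<bar>) < \<epsilon>)"

text \<open>The derivative on \<open>I\<close>, one-sided at the end points.\<close>

definition D :: "(real \<Rightarrow> real) \<Rightarrow> real \<Rightarrow> real" where
  "D u t = vector_derivative u (at t within I)"

definition W21 :: "(real \<Rightarrow> real) set" where
  "W21 = {u. u differentiable_on I \<and> absolutely_continuous_on I (D u)}"

definition X_D :: "(real \<Rightarrow> real) set" where
  "X_D = {u \<in> W21. u 0 = 0 \<and> u 1 = 0}"

definition X_N :: "(real \<Rightarrow> real) set" where
  "X_N = {u \<in> W21. D u 0 = 0 \<and> D u 1 = 0}"

definition L :: "(real \<Rightarrow> real) \<Rightarrow> real \<Rightarrow> (real \<Rightarrow> real) \<Rightarrow> real \<Rightarrow> real" where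
  "L a lam u t = D (D u) t + (a t + lam) * u t"

text \<open>The equation \<open>L[\<lambda>]u = \<sigma>\<close> almost everywhere on \<open>I\<close>. Since \<open>D\<close> is a total operator, the existence
  of the second derivative is part of the condition.\<close>

definition solves ::
  "(real \<Rightarrow> real) \<Rightarrow> real \<Rightarrow> (real \<Rightarrow> real) \<Rightarrow> (real \<Rightarrow> real) \<Rightarrow> bool" where
  "solves a lam \<sigma> u \<longleftrightarrow>
    (AE t\<in>I in lebesgue. D u differentiable (at t within I) \<and> L a lam u t = \<sigma> t)"

definition nonresonant :: "(real \<Rightarrow> real) set \<Rightarrow> (real \<Rightarrow> real) \<Rightarrow> real \<Rightarrow> bool" where
  "nonresonant X a lam \<longleftrightarrow> (\<forall>u\<in>X. solves a lam (\<lambda>_. 0) u \<longrightarrow> (\<forall>t\<in>I. u t = 0))"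

definition eigenvalue :: "(real \<Rightarrow> real) set \<Rightarrow> (real \<Rightarrow> real) \<Rightarrow> real \<Rightarrow> bool" where
  "eigenvalue X a lam \<longleftrightarrow> (\<exists>u\<in>X. solves a lam (\<lambda>_. 0) u \<and> (\<exists>t\<in>I. u t \<noteq> 0))"

definition first_eigenvalue :: "(real \<Rightarrow> real) set \<Rightarrow> (real \<Rightarrow> real) \<Rightarrow> real" where
  "first_eigenvalue X a = (LEAST lam. eigenvalue X a lam)"

text \<open>The values of a Green's function outside the square \<open>I \<times> I\<close> are fixed by \<open>extensional\<close>, so that
  it is unique as a total function. Uniqueness of the solution of the boundary value problem is
  nonresonance.\<close>

definition is_green ::
  "(real \<Rightarrow> real) set \<Rightarrow> (real \<Rightarrow> real) \<Rightarrow> real \<Rightarrow> (real \<times> real \<Rightarrow> real) \<Rightarrow> bool" where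
  "is_green X a lam G \<longleftrightarrow>
    nonresonant X a lam \<and>
    G \<in> extensional (I \<times> I) \<and>
    continuous_on (I \<times> I) G \<and>
    (\<forall>\<sigma>. \<sigma> absolutely_integrable_on I \<longrightarrow>
      (\<lambda>t. LINT s:I|lebesgue. G (t, s) * \<sigma> s) \<in> X \<and>
      solves a lam \<sigma> (\<lambda>t. LINT s:I|lebesgue. G (t, s) * \<sigma> s))"

definition green ::
  "(real \<Rightarrow> real) set \<Rightarrow> (real \<Rightarrow> real) \<Rightarrow> real \<Rightarrow> real \<times> real \<Rightarrow> real" where
  "green X a lam = (THE G. is_green X a lam G)"

abbreviation G_D :: "(real \<Rightarrow> real) \<Rightarrow> real \<Rightarrow> real \<times> real \<Rightarrow> real" where
  "G_D \<equiv> green X_D"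

abbreviation G_N :: "(real \<Rightarrow> real) \<Rightarrow> real \<Rightarrow> real \<times> real \<Rightarrow> real" where
  "G_N \<equiv> green X_N"

end

theory Submission
  imports Defs
begin

text \<open>Let \<open>c\<close> be the solution of \<open>c'' + (a + \<lambda>) c = 0\<close> with \<open>c(0) = 1\<close> and \<open>c'(0) = 0\<close>. Below the first
  Neumann eigenvalue \<open>c > 0\<close> on \<open>I\<close> and \<open>c'(1) > 0\<close>
  (\<open>less_first_Neumann_eigenvalue_imp_subcritical\<close>). Given this, put \<open>R(t) = \<integral>\<^sub>0\<^sup>t c\<^sup>-\<^sup>2\<close>. By reduction of
  order every solution is \<open>c (\<alpha> + \<beta> R)\<close>, and gluing the solutions that satisfy the boundary conditions at
  the two ends gives, with \<open>m = min t s\<close> and \<open>M = max t s\<close>,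

  \<^item> \<open>G_D(t, s) = - c(m) c(M) R(m) (R(1) - R(M)) / R(1)\<close>,

  \<^item> \<open>G_N(t, s) = - c(m) c(M) (R(1) - R(M) + 1 / (c(1) c'(1)))\<close>.

  Since \<open>0 < R(m) < R(1)\<close> and \<open>R(M) < R(1)\<close> for interior points, both inequalities are immediate
  (\<open>green_comparison\<close>).

  To locate the first eigenvalue, consider the set of \<open>\<lambda>\<close> for which \<open>c > 0\<close> and \<open>c'(1) > 0\<close>. It is
  open by continuous dependence on \<open>\<lambda>\<close>, contains all sufficiently negative \<open>\<lambda>\<close>, and is bounded above by
  a Riccati argument. At the infimum of its complement \<open>c\<close> is still positive, because a zero would be a
  double zero, so \<open>c'(1) = 0\<close> and \<open>c\<close> is an eigenfunction; smaller parameters are nonresonant by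
  reduction of order.

  The coefficient \<open>a\<close> is only integrable, which enters in two ways. Existence and dependence on \<open>\<lambda>\<close> are
  obtained from the first-order system for \<open>c\<close> and the quasi-derivative \<open>c' + A c\<close>, where \<open>A\<close> is a
  primitive of \<open>a\<close>; its coefficients are continuous. Second derivatives exist only almost everywhere and
  are handled by two facts: an integral is absolutely continuous and differentiable almost everywhere with
  the expected derivative (\<open>absolutely_continuous_on_integral\<close>, \<open>lebesgue_differentiation\<close>), and an
  absolutely continuous function with derivative zero almost everywhere is constant
  (\<open>absolutely_continuous_derivative_zero_imp_eq\<close>).\<close>

section \<open>The Lebesgue differentiation theorem on an interval\<close>

text \<open>A point is bad when arbitrarily short intervals around it have an average that misses the value of
  the function by more than \<open>e\<close>. By Henstock's lemma, the intervals of a gauge-fine partial division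
  contribute a total error below any prescribed bound; bad intervals contribute at least \<open>e\<close> times
  their length, so disjoint fine bad intervals have small total length. Vitali's theorem covers almost
  all bad points by such a family.\<close>

lemma negligible_bad_averages:
  fixes f :: "real \<Rightarrow> real"
  assumes f: "f integrable_on {a..b}" and e: "e > 0"
  shows "negligible {x. \<forall>d>0. \<exists>u v. u < v \<and> v - u < d \<and> x \<in> {u..v} \<and> {u..v} \<subseteq> {a..b} \<and>
            e * (v - u) < \<bar>f x * (v - u) - integral {u..v} f\<bar>}"
    (is "negligible ?B")
  unfolding negligible_outer_le
proof (intro allI impI)
  fix \<eta> :: real assume "\<eta> > 0"
  then have e\<eta>: "e * \<eta> > 0" using e by simp
  have f': "f integrable_on cbox a b" using f by simp
  obtain \<gamma> where "gauge \<gamma>"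
    and \<gamma>: "\<And>p. \<lbrakk>p tagged_partial_division_of (cbox a b); \<gamma> fine p\<rbrakk> \<Longrightarrow>
             (\<Sum>(x,k)\<in>p. norm (measure lborel k *\<^sub>R f x - integral k f)) < e * \<eta>"
    by (rule Henstock_lemma[OF f' e\<eta>]) blast
  \<comment> \<open>The covering family remembers the tag \<open>x\<close>, since Henstock's lemma speaks about tagged intervals.\<close>
  define K where "K = {(x, u, v). u < v \<and> x \<in> {u..v} \<and> {u..v} \<subseteq> {a..b} \<and> {u..v} \<subseteq> \<gamma> x \<and>
                         e * (v - u) < \<bar>f x * (v - u) - integral {u..v} f\<bar>}"
  define J where "J = (\<lambda>i::real\<times>real\<times>real. {fst (snd i)..snd (snd i)})"
  define c where "c = (\<lambda>i::real\<times>real\<times>real. (fst (snd i) + snd (snd i)) / 2)"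
  define r where "r = (\<lambda>i::real\<times>real\<times>real. (snd (snd i) - fst (snd i)) / 2)"
  have J: "cball (c i) (r i) = J i" for i
    by (auto simp: c_def r_def J_def cball_eq_atLeastAtMost field_simps)
  obtain C where C: "countable C" "C \<subseteq> K"
     "pairwise (\<lambda>i j. disjnt (cball (c i) (r i)) (cball (c j) (r j))) C"
     "negligible (?B - (\<Union>i\<in>C. cball (c i) (r i)))"
  proof (rule Vitali_covering_theorem_cballs[of K r ?B c])
    show "0 < r i" if "i \<in> K" for i using that by (auto simp: K_def r_def)
    fix x d :: real assume x: "x \<in> ?B" and "0 < d"
    obtain \<delta> where "\<delta> > 0" "ball x \<delta> \<subseteq> \<gamma> x"
      using \<open>gauge \<gamma>\<close> by (meson gauge_def open_contains_ball)
    moreover have m: "min d \<delta> > 0" using \<open>0 < d\<close> \<open>\<delta> > 0\<close> by simp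
    moreover obtain u v where "u < v" "v - u < min d \<delta>" "x \<in> {u..v}" "{u..v} \<subseteq> {a..b}"
       "e * (v - u) < \<bar>f x * (v - u) - integral {u..v} f\<bar>"
      using x[unfolded mem_Collect_eq, rule_format, OF m] by blast
    moreover have "{u..v} \<subseteq> ball x \<delta>"
      using calculation by (auto simp: dist_real_def)
    ultimately have "(x, u, v) \<in> K" "x \<in> J (x, u, v)" "r (x, u, v) < d"
      by (auto simp: K_def J_def r_def)
    then show "\<exists>i. i \<in> K \<and> x \<in> cball (c i) (r i) \<and> r i < d"
      unfolding J by blast
  qed blast
  note C = C[unfolded J]
  have bound: "measure lebesgue (\<Union>i\<in>C'. J i) \<le> \<eta>" if C': "C' \<subseteq> C" "finite C'" for C'
  proof -
    define p where "p = (\<lambda>i. (fst i, J i)) ` C'"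
    have inj: "inj_on (\<lambda>i. (fst i, J i)) C'"
      using C(2) C'(1) by (auto simp: inj_on_def J_def K_def)
    have len: "measure lborel (J i) = snd (snd i) - fst (snd i)" if "i \<in> C'" for i
      using that C(2) C'(1) by (auto simp: J_def K_def)
    have "p tagged_partial_division_of (cbox a b)"
      unfolding tagged_partial_division_of_def
    proof (intro conjI allI impI)
      show "finite p" using C'(2) by (simp add: p_def)
      fix x k assume "(x, k) \<in> p"
      then obtain u v where "(x, u, v) \<in> K" "k = {u..v}"
        using C(2) C'(1) unfolding p_def J_def by auto
      then show "x \<in> k" "k \<subseteq> cbox a b" "\<exists>a b. k = cbox a b"
        unfolding K_def by auto
    next
      fix x1 K1 x2 K2 assume "(x1, K1) \<in> p \<and> (x2, K2) \<in> p \<and> (x1, K1) \<noteq> (x2, K2)"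
      moreover from this obtain i j where "i \<in> C'" "(x1, K1) = (fst i, J i)" "j \<in> C'" "(x2, K2) = (fst j, J j)"
        unfolding p_def by blast
      ultimately have "i \<in> C" "j \<in> C" "i \<noteq> j" "K1 = J i" "K2 = J j"
        using C'(1) by auto
      then have "disjnt K1 K2" using C(3) by (auto simp: pairwise_def)
      then show "interior K1 \<inter> interior K2 = {}"
        using interior_subset by (fastforce simp: disjnt_def)
    qed
    moreover have "\<gamma> fine p"
      using C(2) C'(1) by (force simp: fine_def p_def J_def K_def)
    ultimately have "(\<Sum>(x,k)\<in>p. norm (measure lborel k *\<^sub>R f x - integral k f)) < e * \<eta>"
      by (rule \<gamma>)
    also have "(\<Sum>(x,k)\<in>p. norm (measure lborel k *\<^sub>R f x - integral k f))
        = (\<Sum>i\<in>C'. \<bar>measure lborel (J i) * f (fst i) - integral (J i) f\<bar>)"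
      unfolding p_def by (subst sum.reindex[OF inj]) simp
    finally have "(\<Sum>i\<in>C'. \<bar>measure lborel (J i) * f (fst i) - integral (J i) f\<bar>) < e * \<eta>" .
    moreover have "(\<Sum>i\<in>C'. e * measure lborel (J i)) \<le> (\<Sum>i\<in>C'. \<bar>measure lborel (J i) * f (fst i) - integral (J i) f\<bar>)"
    proof (rule sum_mono)
      fix i assume i: "i \<in> C'"
      then have "i \<in> K" using C(2) C'(1) by auto
      then show "e * measure lborel (J i) \<le> \<bar>measure lborel (J i) * f (fst i) - integral (J i) f\<bar>"
        unfolding len[OF i] by (auto simp: K_def J_def mult.commute)
    qed
    ultimately have "e * (\<Sum>i\<in>C'. measure lborel (J i)) < e * \<eta>"
      by (simp add: sum_distrib_left)
    then have "(\<Sum>i\<in>C'. measure lborel (J i)) < \<eta>" using e by simp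
    moreover have "measure lebesgue (\<Union>i\<in>C'. J i) \<le> (\<Sum>i\<in>C'. measure lebesgue (J i))"
      by (rule measure_UNION_le) (auto simp: C' J_def)
    ultimately show ?thesis by (simp add: J_def)
  qed
  have meas: "J i \<in> lmeasurable" for i by (simp add: J_def)
  have "(\<Union>i\<in>C. J i) \<in> lmeasurable" "measure lebesgue (\<Union>i\<in>C. J i) \<le> \<eta>"
    using fmeasurable_UN_bound[OF C(1) meas bound] measure_UN_bound[OF C(1) meas bound] by auto
  moreover define R where "R = ?B - (\<Union>i\<in>C. J i)"
  moreover have "R \<in> lmeasurable" "measure lebesgue R = 0"
    using C(4) by (auto simp: negligible_iff_measure R_def)
  moreover have "measure lebesgue ((\<Union>i\<in>C. J i) \<union> R) \<le> measure lebesgue (\<Union>i\<in>C. J i) + measure lebesgue R"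
    by (rule measure_Un_le) (use calculation in auto)
  ultimately show "\<exists>T. ?B \<subseteq> T \<and> T \<in> lmeasurable \<and> measure lebesgue T \<le> \<eta>"
    by (intro exI[of _ "(\<Union>i\<in>C. J i) \<union> R"] conjI fmeasurable.Un) (simp_all add: Un_Diff_cancel)
qed

theorem lebesgue_differentiation:
  fixes f :: "real \<Rightarrow> real"
  assumes f: "f integrable_on {a..b}"
  shows "AE t\<in>{a..b} in lebesgue.
           ((\<lambda>t. integral {a..t} f) has_real_derivative f t) (at t within {a..b})"
proof -
  define B where "B = (\<lambda>e. {x. \<forall>d>0. \<exists>u v. u < v \<and> v - u < d \<and> x \<in> {u..v} \<and> {u..v} \<subseteq> {a..b} \<and>
            e * (v - u) < \<bar>f x * (v - u) - integral {u..v} f\<bar>})"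
  define N where "N = (\<Union>n. B (inverse (real (Suc n))))"
  have "negligible N"
    unfolding N_def B_def by (intro negligible_Union_nat negligible_bad_averages f) simp
  moreover have "((\<lambda>t. integral {a..t} f) has_real_derivative f t) (at t within {a..b})"
    if t: "t \<in> {a..b}" "t \<notin> N" for t
    unfolding has_field_derivative_def has_derivative_within_alt
  proof (intro conjI allI impI)
    show "bounded_linear ((*) (f t))" by (rule bounded_linear_mult_right)
    fix e :: real assume "e > 0"
    then obtain n where n: "inverse (real (Suc n)) < e" using reals_Archimedean by blast
    have "t \<notin> B (inverse (real (Suc n)))" using t(2) by (auto simp: N_def)
    then obtain d where "d > 0" and d: "\<And>u v. \<lbrakk>u < v; v - u < d; t \<in> {u..v}; {u..v} \<subseteq> {a..b}\<rbrakk> \<Longrightarrow>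
        \<bar>f t * (v - u) - integral {u..v} f\<bar> \<le> inverse (real (Suc n)) * (v - u)"
      unfolding B_def mem_Collect_eq by (metis not_less)
    have d': "\<bar>f t * (v - u) - integral {u..v} f\<bar> \<le> e * (v - u)"
      if "u < v" "v - u < d" "t \<in> {u..v}" "{u..v} \<subseteq> {a..b}" for u v
      using d[OF that] mult_right_mono[of "inverse (real (Suc n))" e "v - u"] n that(1) by linarith
    have "norm (integral {a..y} f - integral {a..t} f - f t * (y - t)) \<le> e * norm (y - t)"
      if y: "y \<in> {a..b}" "norm (y - t) < d" for y
    proof -
      consider "y = t" | "t < y" | "y < t" by linarith
      then show ?thesis
      proof cases
        case 2
        then have "integral {a..t} f + integral {t..y} f = integral {a..y} f"
          using t y by (intro Henstock_Kurzweil_Integration.integral_combine integrable_on_subinterval[OF f]) auto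
        then show ?thesis using d'[of t y] 2 t y by (auto simp: abs_minus_commute)
      next
        case 3
        then have "integral {a..y} f + integral {y..t} f = integral {a..t} f"
          using t y by (intro Henstock_Kurzweil_Integration.integral_combine integrable_on_subinterval[OF f]) auto
        then show ?thesis using d'[of y t] 3 t y by (auto simp: algebra_simps)
      qed simp
    qed
    then show "\<exists>d>0. \<forall>y\<in>{a..b}. norm (y - t) < d \<longrightarrow>
        norm (integral {a..y} f - integral {a..t} f - f t * (y - t)) \<le> e * norm (y - t)"
      using \<open>d > 0\<close> by blast
  qed
  ultimately show ?thesis
    unfolding eventually_ae_filter_negligible by blast
qed

section \<open>Absolutely continuous functions\<close>

lemma absolutely_continuous_onD:
  assumes "absolutely_continuous_on S f" "\<epsilon> > 0"
  obtains \<delta> where "\<delta> > 0"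
    "\<And>P. \<lbrakk>finite P; \<And>x y. (x, y) \<in> P \<Longrightarrow> x \<le> y \<and> {x..y} \<subseteq> S;
      disjoint_family_on (\<lambda>(x, y). {x<..<y}) P; (\<Sum>(x, y)\<in>P. y - x) < \<delta>\<rbrakk>
      \<Longrightarrow> (\<Sum>(x, y)\<in>P. \<bar>f y - f x\<bar>) < \<epsilon>"
proof -
  obtain \<delta> where "\<delta> > 0" and \<delta>: "\<forall>P. finite P \<longrightarrow>
      (\<forall>(x, y)\<in>P. x \<le> y \<and> {x..y} \<subseteq> S) \<longrightarrow>
      disjoint_family_on (\<lambda>(x, y). {x<..<y}) P \<longrightarrow>
      (\<Sum>(x, y)\<in>P. y - x) < \<delta> \<longrightarrow>
      (\<Sum>(x, y)\<in>P. \<bar>f y - f x\<bar>) < \<epsilon>"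
    using assms unfolding absolutely_continuous_on_def by meson
  show ?thesis
    by (rule that[OF \<open>\<delta> > 0\<close>], rule \<delta>[rule_format]) auto
qed

text \<open>Lipschitz functions, sums and products are all reduced to this: the increments of the new function
  are controlled by those of two functions already known to be absolutely continuous.\<close>

lemma absolutely_continuous_on_dominated:
  assumes f: "absolutely_continuous_on S f" and g: "absolutely_continuous_on S g"
    and h: "\<And>x y. x \<in> S \<Longrightarrow> y \<in> S \<Longrightarrow> \<bar>h y - h x\<bar> \<le> C * \<bar>f y - f x\<bar> + C * \<bar>g y - g x\<bar>"
    and C: "C > 0"
  shows "absolutely_continuous_on S h"
  unfolding absolutely_continuous_on_def
proof (intro allI impI)
  fix \<epsilon> :: real assume "\<epsilon> > 0"
  then have e: "\<epsilon> / (2 * C) > 0" using C by simp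
  obtain \<delta>1 where "\<delta>1 > 0" and \<delta>1: "\<And>P. \<lbrakk>finite P; \<And>x y. (x, y) \<in> P \<Longrightarrow> x \<le> y \<and> {x..y} \<subseteq> S;
      disjoint_family_on (\<lambda>(x, y). {x<..<y}) P; (\<Sum>(x, y)\<in>P. y - x) < \<delta>1\<rbrakk>
      \<Longrightarrow> (\<Sum>(x, y)\<in>P. \<bar>f y - f x\<bar>) < \<epsilon> / (2 * C)"
    using absolutely_continuous_onD[OF f e] by blast
  obtain \<delta>2 where "\<delta>2 > 0" and \<delta>2: "\<And>P. \<lbrakk>finite P; \<And>x y. (x, y) \<in> P \<Longrightarrow> x \<le> y \<and> {x..y} \<subseteq> S;
      disjoint_family_on (\<lambda>(x, y). {x<..<y}) P; (\<Sum>(x, y)\<in>P. y - x) < \<delta>2\<rbrakk>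
      \<Longrightarrow> (\<Sum>(x, y)\<in>P. \<bar>g y - g x\<bar>) < \<epsilon> / (2 * C)"
    using absolutely_continuous_onD[OF g e] by blast
  have "(\<Sum>(x, y)\<in>P. \<bar>h y - h x\<bar>) < \<epsilon>"
    if P: "finite P" "\<forall>(x, y)\<in>P. x \<le> y \<and> {x..y} \<subseteq> S"
       "disjoint_family_on (\<lambda>(x, y). {x<..<y}) P" "(\<Sum>(x, y)\<in>P. y - x) < min \<delta>1 \<delta>2" for P
  proof -
    have S: "x \<in> S" "y \<in> S" if "(x, y) \<in> P" for x y
      using P(2) that by force+
    have "(\<Sum>(x, y)\<in>P. \<bar>f y - f x\<bar>) < \<epsilon> / (2 * C)" "(\<Sum>(x, y)\<in>P. \<bar>g y - g x\<bar>) < \<epsilon> / (2 * C)"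
      using P by (auto intro!: \<delta>1 \<delta>2)
    then have "C * (\<Sum>(x, y)\<in>P. \<bar>f y - f x\<bar>) + C * (\<Sum>(x, y)\<in>P. \<bar>g y - g x\<bar>) < \<epsilon>"
      using C by (simp add: field_simps)
    moreover have "(\<Sum>(x, y)\<in>P. \<bar>h y - h x\<bar>) \<le> (\<Sum>(x, y)\<in>P. C * \<bar>f y - f x\<bar> + C * \<bar>g y - g x\<bar>)"
      by (rule sum_mono) (use h S in auto)
    ultimately show ?thesis
      by (simp add: sum_distrib_left sum.distrib case_prod_unfold)
  qed
  then show "\<exists>\<delta>>0. \<forall>P. finite P \<longrightarrow> (\<forall>(x, y)\<in>P. x \<le> y \<and> {x..y} \<subseteq> S) \<longrightarrow>
      disjoint_family_on (\<lambda>(x, y). {x<..<y}) P \<longrightarrow> (\<Sum>(x, y)\<in>P. y - x) < \<delta> \<longrightarrow>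
      (\<Sum>(x, y)\<in>P. \<bar>h y - h x\<bar>) < \<epsilon>"
    using \<open>\<delta>1 > 0\<close> \<open>\<delta>2 > 0\<close> by (intro exI[of _ "min \<delta>1 \<delta>2"]) auto
qed

lemma absolutely_continuous_on_ident: "absolutely_continuous_on S (\<lambda>x. x)"
proof -
  have "(\<Sum>(x, y)\<in>P. \<bar>y - x\<bar>) = (\<Sum>(x, y)\<in>P. y - x)"
    if "\<forall>(x, y)\<in>P. x \<le> y \<and> {x..y} \<subseteq> S" for P :: "(real \<times> real) set"
    using that by (intro sum.cong) auto
  then show ?thesis
    unfolding absolutely_continuous_on_def by auto
qed

lemma absolutely_continuous_on_Lipschitz:
  assumes "\<And>x y. x \<in> S \<Longrightarrow> y \<in> S \<Longrightarrow> \<bar>f y - f x\<bar> \<le> C * \<bar>y - x\<bar>"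
  shows "absolutely_continuous_on S f"
proof (rule absolutely_continuous_on_dominated)
  show "absolutely_continuous_on S (\<lambda>x. x)" "absolutely_continuous_on S (\<lambda>x. x)"
    by (rule absolutely_continuous_on_ident)+
  show "max 1 C > 0" by simp
  fix x y assume xy: "x \<in> S" "y \<in> S"
  have "C * \<bar>y - x\<bar> \<le> max 1 C * \<bar>y - x\<bar>" "0 \<le> max 1 C * \<bar>y - x\<bar>" by (auto intro: mult_right_mono)
  then show "\<bar>f y - f x\<bar> \<le> max 1 C * \<bar>y - x\<bar> + max 1 C * \<bar>y - x\<bar>" using assms[OF xy] by linarith
qed

lemma absolutely_continuous_on_cong:
  assumes "absolutely_continuous_on S f" "\<And>x. x \<in> S \<Longrightarrow> f x = g x"
  shows "absolutely_continuous_on S g"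
  by (rule absolutely_continuous_on_dominated[OF assms(1,1), of _ 1]) (auto simp: assms(2))

lemma absolutely_continuous_on_add:
  assumes "absolutely_continuous_on S f" "absolutely_continuous_on S g"
  shows "absolutely_continuous_on S (\<lambda>x. f x + g x)"
  by (rule absolutely_continuous_on_dominated[OF assms, of _ 1]) auto

lemma absolutely_continuous_on_Icc_imp_continuous:
  assumes f: "absolutely_continuous_on {a..b} f"
  shows "continuous_on {a..b} f"
  unfolding continuous_on_iff
proof (intro ballI allI impI)
  fix x e :: real assume x: "x \<in> {a..b}" and "e > 0"
  obtain \<delta> where "\<delta> > 0" and \<delta>: "\<And>P. \<lbrakk>finite P; \<And>x y. (x, y) \<in> P \<Longrightarrow> x \<le> y \<and> {x..y} \<subseteq> {a..b};
      disjoint_family_on (\<lambda>(x, y). {x<..<y}) P; (\<Sum>(x, y)\<in>P. y - x) < \<delta>\<rbrakk>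
      \<Longrightarrow> (\<Sum>(x, y)\<in>P. \<bar>f y - f x\<bar>) < e"
    using absolutely_continuous_onD[OF f \<open>e > 0\<close>] by blast
  have "dist (f y) (f x) < e" if y: "y \<in> {a..b}" "dist y x < \<delta>" for y
  proof (cases "x \<le> y")
    case True
    then show ?thesis
      using \<delta>[of "{(x, y)}"] x y by (auto simp: dist_real_def disjoint_family_on_def)
  next
    case False
    then show ?thesis
      using \<delta>[of "{(y, x)}"] x y by (auto simp: dist_real_def disjoint_family_on_def)
  qed
  then show "\<exists>d>0. \<forall>x'\<in>{a..b}. dist x' x < d \<longrightarrow> dist (f x') (f x) < e"
    using \<open>\<delta> > 0\<close> by blast
qed

lemma absolutely_continuous_on_Icc_mult:
  assumes f: "absolutely_continuous_on {a..b} f" and g: "absolutely_continuous_on {a..b} g"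
  shows "absolutely_continuous_on {a..b} (\<lambda>x. f x * g x)"
proof -
  have "bounded (f ` {a..b})" "bounded (g ` {a..b})"
    using f g by (auto intro!: compact_imp_bounded compact_continuous_image
        absolutely_continuous_on_Icc_imp_continuous)
  then obtain A B where "A > 0" "\<forall>x\<in>{a..b}. \<bar>f x\<bar> \<le> A" "B > 0" "\<forall>x\<in>{a..b}. \<bar>g x\<bar> \<le> B"
    unfolding bounded_pos by auto
  then have A: "\<And>x. x \<in> {a..b} \<Longrightarrow> \<bar>f x\<bar> \<le> A" "A > 0" and B: "\<And>x. x \<in> {a..b} \<Longrightarrow> \<bar>g x\<bar> \<le> B" "B > 0"
    by auto
  show ?thesis
  proof (rule absolutely_continuous_on_dominated[OF f g])
    show "max A B > 0" using A(2) by simp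
    fix x y assume xy: "x \<in> {a..b}" "y \<in> {a..b}"
    have "f y * g y - f x * g x = g y * (f y - f x) + f x * (g y - g x)" by (simp add: algebra_simps)
    also have "\<bar>\<dots>\<bar> \<le> \<bar>g y\<bar> * \<bar>f y - f x\<bar> + \<bar>f x\<bar> * \<bar>g y - g x\<bar>"
      by (metis abs_mult abs_triangle_ineq)
    also have "\<dots> \<le> max A B * \<bar>f y - f x\<bar> + max A B * \<bar>g y - g x\<bar>"
      using A(1)[OF xy(1)] B(1)[OF xy(2)] by (intro add_mono mult_right_mono) auto
    finally show "\<bar>f y * g y - f x * g x\<bar> \<le> max A B * \<bar>f y - f x\<bar> + max A B * \<bar>g y - g x\<bar>" .
  qed
qed

lemma sum_integral_disjoint_le:
  fixes h :: "real \<Rightarrow> real"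
  assumes h: "h integrable_on {a..b}" "\<And>x. x \<in> {a..b} \<Longrightarrow> 0 \<le> h x"
    and P: "finite P" "\<And>x y. (x, y) \<in> P \<Longrightarrow> {x..y} \<subseteq> {a..b}"
      "disjoint_family_on (\<lambda>(x, y). {x<..<y}) P"
  shows "(\<Sum>(x, y)\<in>P. integral {x..y} h) \<le> integral {a..b} h"
proof -
  define T where "T = (\<lambda>(x, y). {x<..<y::real})"
  define g where "g = (\<lambda>(x, y). integral {x..y} h)"
  have "(h has_integral g i) (T i)" if i: "i \<in> P" for i
  proof -
    obtain x y where "i = (x, y)" by fastforce
    then show ?thesis
      using i P(2) integrable_on_subinterval[OF h(1), of x y]
      by (auto simp: T_def g_def has_integral_Icc_iff_Ioo[symmetric] integrable_integral)
  qed
  moreover have "pairwise (\<lambda>i j. negligible (T i \<inter> T j)) P"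
    using P(3) by (auto simp: pairwise_def disjoint_family_on_def T_def)
  ultimately have U: "(h has_integral (sum g P)) (\<Union>i\<in>P. T i)"
    by (rule has_integral_UN[OF P(1)])
  then have "sum g P = integral (\<Union>i\<in>P. T i) h" by (simp add: integral_unique)
  also have "\<dots> \<le> integral {a..b} h"
  proof (rule integral_subset_le)
    show "(\<Union>i\<in>P. T i) \<subseteq> {a..b}"
      using P(2) by (fastforce simp: T_def)
  qed (use U h in auto)
  finally show ?thesis by (simp add: g_def)
qed

text \<open>Truncate \<open>|f|\<close> at height \<open>n\<close>. The part above the truncation has small integral for large \<open>n\<close> by
  dominated convergence, and the part below contributes at most \<open>n\<close> times the total length of the
  intervals.\<close>

theorem absolutely_continuous_on_integral:
  fixes f :: "real \<Rightarrow> real"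
  assumes f: "f absolutely_integrable_on {a..b}"
  shows "absolutely_continuous_on {a..b} (\<lambda>t. integral {a..t} f)"
  unfolding absolutely_continuous_on_def
proof (intro allI impI)
  fix \<epsilon> :: real assume "\<epsilon> > 0"
  let ?M = "lebesgue_on {a..b}"
  define tail where "tail = (\<lambda>n x. \<bar>f x\<bar> - min \<bar>f x\<bar> (real n))"
  have fM: "integrable ?M f" using absolutely_integrable_imp_integrable[OF f] by simp
  then have [measurable]: "f \<in> borel_measurable ?M" by simp
  have "(\<lambda>n. integral\<^sup>L ?M (tail n)) \<longlonglongrightarrow> integral\<^sup>L ?M (\<lambda>x. 0)"
  proof (rule integral_dominated_convergence)
    show "integrable ?M (\<lambda>x. \<bar>f x\<bar>)" using fM by simp
    show "AE x in ?M. (\<lambda>n. tail n x) \<longlonglongrightarrow> 0"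
    proof (intro AE_I2 tendsto_eventually)
      fix x
      obtain N where "\<bar>f x\<bar> \<le> real N" using real_arch_simple by blast
      then show "\<forall>\<^sub>F n in sequentially. tail n x = 0"
        unfolding eventually_sequentially tail_def by (intro exI[of _ N]) auto
    qed
    show "AE x in ?M. norm (tail n x) \<le> \<bar>f x\<bar>" for n by (auto simp: tail_def)
    show "tail n \<in> borel_measurable ?M" for n unfolding tail_def by measurable
  qed simp
  then have "\<forall>\<^sub>F n in sequentially. integral\<^sup>L ?M (tail n) < \<epsilon> / 2"
    using \<open>\<epsilon> > 0\<close> by (intro order_tendstoD(2)) auto
  then obtain n where n: "integral\<^sup>L ?M (tail n) < \<epsilon> / 2"
    by (auto simp: eventually_sequentially)
  have tM: "integrable ?M (tail n)"
    by (rule Bochner_Integration.integrable_bound[OF fM]) (auto simp: tail_def)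
  then have t: "tail n integrable_on {a..b}" "integral {a..b} (tail n) < \<epsilon> / 2"
    using n lebesgue_integral_eq_integral[OF tM] integrable_on_lebesgue_on[OF tM] by auto
  \<comment> \<open>\<open>n + 1\<close> instead of \<open>n\<close> keeps the denominator positive.\<close>
  define \<delta> where "\<delta> = \<epsilon> / (2 * (real n + 1))"
  have "\<delta> > 0" using \<open>\<epsilon> > 0\<close> by (simp add: \<delta>_def)
  moreover have "(\<Sum>(x, y)\<in>P. \<bar>integral {a..y} f - integral {a..x} f\<bar>) < \<epsilon>"
    if P: "finite P" "\<forall>(x, y)\<in>P. x \<le> y \<and> {x..y} \<subseteq> {a..b}"
       "disjoint_family_on (\<lambda>(x, y). {x<..<y}) P" "(\<Sum>(x, y)\<in>P. y - x) < \<delta>" for P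
  proof -
    have "\<bar>integral {a..y} f - integral {a..x} f\<bar> \<le> integral {x..y} (tail n) + (real n + 1) * (y - x)"
      if "(x, y) \<in> P" for x y
    proof -
      have xy: "x \<le> y" "{x..y} \<subseteq> {a..b}" "a \<le> x" "y \<le> b" using P(2) that by auto
      have f': "f integrable_on {a..b}" using f by (simp add: absolutely_integrable_on_def)
      have tn: "tail n integrable_on {x..y}" by (rule integrable_on_subinterval[OF t(1) xy(2)])
      have "integral {a..y} f - integral {a..x} f = integral {x..y} f"
        using xy Henstock_Kurzweil_Integration.integral_combine[of a x y f]
          integrable_on_subinterval[OF f', of a y] by auto
      also have "\<bar>\<dots>\<bar> \<le> integral {x..y} (\<lambda>u. tail n u + (real n + 1))"
        unfolding real_norm_def[symmetric]
        by (rule integral_norm_bound_integral)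
           (use xy integrable_on_subinterval[OF f' xy(2)] tn in \<open>auto simp: tail_def intro!: integrable_add\<close>)
      also have "\<dots> = integral {x..y} (tail n) + (real n + 1) * (y - x)"
        using xy tn by (subst integral_add) auto
      finally show ?thesis .
    qed
    then have "(\<Sum>(x, y)\<in>P. \<bar>integral {a..y} f - integral {a..x} f\<bar>)
      \<le> (\<Sum>(x, y)\<in>P. integral {x..y} (tail n) + (real n + 1) * (y - x))"
      by (intro sum_mono) auto
    also have "\<dots> = (\<Sum>(x, y)\<in>P. integral {x..y} (tail n)) + (real n + 1) * (\<Sum>(x, y)\<in>P. y - x)"
      by (simp add: sum.distrib sum_distrib_left case_prod_unfold)
    also have "(\<Sum>(x, y)\<in>P. integral {x..y} (tail n)) \<le> integral {a..b} (tail n)"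
      using P by (intro sum_integral_disjoint_le t) (auto simp: tail_def)
    also have "(real n + 1) * (\<Sum>(x, y)\<in>P. y - x) \<le> (real n + 1) * \<delta>"
      using P(4) by (intro mult_left_mono) auto
    also have "(real n + 1) * \<delta> = \<epsilon> / 2" unfolding \<delta>_def by (simp add: field_simps)
    finally show ?thesis using t(2) by simp
  qed
  ultimately show "\<exists>\<delta>>0. \<forall>P. finite P \<longrightarrow> (\<forall>(x, y)\<in>P. x \<le> y \<and> {x..y} \<subseteq> {a..b}) \<longrightarrow>
      disjoint_family_on (\<lambda>(x, y). {x<..<y}) P \<longrightarrow> (\<Sum>(x, y)\<in>P. y - x) < \<delta> \<longrightarrow>
      (\<Sum>(x, y)\<in>P. \<bar>integral {a..y} f - integral {a..x} f\<bar>) < \<epsilon>"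
    by blast
qed

text \<open>Choose a fine tagged division. Intervals tagged at a point where the derivative vanishes have
  increments at most \<open>\<epsilon>\<close> times their length. Intervals tagged in the exceptional null set lie in an
  open set of measure below \<open>\<delta>\<close>, so their increments sum to less than \<open>\<epsilon>\<close> by absolute continuity.\<close>

theorem absolutely_continuous_derivative_zero_imp_eq:
  assumes w: "absolutely_continuous_on {a..b} w"
    and d: "AE t\<in>{a..b} in lebesgue. (w has_real_derivative 0) (at t within {a..b})"
    and ab: "a \<le> b"
  shows "w b = w a"
proof -
  obtain N where N: "negligible N"
    and dN: "\<And>t. t \<in> {a..b} \<Longrightarrow> t \<notin> N \<Longrightarrow> (w has_real_derivative 0) (at t within {a..b})"
    using d unfolding eventually_ae_filter_negligible by auto
  have bound: "\<bar>w b - w a\<bar> \<le> \<epsilon> * (b - a + 1)" if "\<epsilon> > 0" for \<epsilon>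
  proof -
    obtain \<delta> where "\<delta> > 0" and \<delta>: "\<And>P. \<lbrakk>finite P; \<And>x y. (x, y) \<in> P \<Longrightarrow> x \<le> y \<and> {x..y} \<subseteq> {a..b};
        disjoint_family_on (\<lambda>(x, y). {x<..<y}) P; (\<Sum>(x, y)\<in>P. y - x) < \<delta>\<rbrakk>
        \<Longrightarrow> (\<Sum>(x, y)\<in>P. \<bar>w y - w x\<bar>) < \<epsilon>"
      using absolutely_continuous_onD[OF w \<open>\<epsilon> > 0\<close>] by blast
    obtain U where U: "open U" "N \<subseteq> U" "U \<in> lmeasurable" "measure lebesgue U < \<delta>"
    proof -
      obtain U where U: "open U" "N \<subseteq> U" "U - N \<in> lmeasurable" "emeasure lebesgue (U - N) < ennreal \<delta>"
        using sets_lebesgue_outer_open[OF negligible_imp_sets[OF N] \<open>\<delta> > 0\<close>] by blast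
      have eq: "U = (U - N) \<union> N" using U(2) by auto
      have "U \<in> lmeasurable"
        by (subst eq) (intro fmeasurable.Un U(3) negligible_imp_measurable[OF N])
      moreover have "measure lebesgue U \<le> measure lebesgue (U - N) + measure lebesgue N"
        by (subst eq, rule measure_Un_le) (use U(3) negligible_imp_sets[OF N] in auto)
      moreover have "measure lebesgue N = 0" using N by (rule negligible_imp_measure0)
      moreover have "measure lebesgue (U - N) < \<delta>"
        using U(3,4) \<open>\<delta> > 0\<close> by (simp add: emeasure_eq_measure2 ennreal_less_iff)
      ultimately show ?thesis using U(1,2) that by auto
    qed
    have "\<exists>r>0. (t \<in> N \<longrightarrow> ball t r \<subseteq> U) \<and>
        (t \<in> {a..b} - N \<longrightarrow> (\<forall>y\<in>{a..b}. \<bar>y - t\<bar> < r \<longrightarrow> \<bar>w y - w t\<bar> \<le> \<epsilon> * \<bar>y - t\<bar>))" for t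
    proof (cases "t \<in> N")
      case True
      then show ?thesis using U(1,2) by (meson Diff_iff open_contains_ball subsetD)
    next
      case False
      show ?thesis
      proof (cases "t \<in> {a..b}")
        case True
        then show ?thesis
          using dN[OF True False] \<open>\<epsilon> > 0\<close> False
          unfolding has_field_derivative_def has_derivative_within_alt by auto
      qed (use False in \<open>auto intro: exI[of _ 1]\<close>)
    qed
    then obtain r where r: "\<And>t. r t > 0" "\<And>t. t \<in> N \<Longrightarrow> ball t (r t) \<subseteq> U"
      and rw: "\<And>t y. \<lbrakk>t \<in> {a..b}; t \<notin> N; y \<in> {a..b}; \<bar>y - t\<bar> < r t\<rbrakk> \<Longrightarrow> \<bar>w y - w t\<bar> \<le> \<epsilon> * \<bar>y - t\<bar>"
      by (metis Diff_iff)
    have "gauge (\<lambda>t. ball t (r t))" using r(1) by (auto simp: gauge_def)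
    then obtain p where p: "p tagged_division_of {a..b}" "(\<lambda>t. ball t (r t)) fine p"
      using fine_division_exists_real by blast
    have fin: "finite p" using p(1) by blast
    have pD: "\<exists>u v. K = {u..v} \<and> u \<le> v \<and> x \<in> {u..v} \<and> {u..v} \<subseteq> {a..b} \<and> {u..v} \<subseteq> ball x (r x)"
      if "(x, K) \<in> p" for x K
    proof -
      have "x \<in> K" "K \<subseteq> {a..b}" "\<exists>u v. K = cbox u v"
        using p(1) that by blast+
      moreover have "K \<subseteq> ball x (r x)" using p(2) that by (auto simp: fine_def)
      ultimately show ?thesis by (auto simp: cbox_interval)
    qed
    let ?q = "{i \<in> p. fst i \<in> N}"
    have "(\<Sum>(x, K)\<in>p. \<bar>w (Sup K) - w (Inf K)\<bar>)
        = (\<Sum>(x, K)\<in>?q. \<bar>w (Sup K) - w (Inf K)\<bar>) + (\<Sum>(x, K)\<in>p - ?q. \<bar>w (Sup K) - w (Inf K)\<bar>)"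
      by (subst sum.subset_diff[of ?q p]) (use fin in auto)
    also have "(\<Sum>(x, K)\<in>p - ?q. \<bar>w (Sup K) - w (Inf K)\<bar>) \<le> (\<Sum>(x, K)\<in>p - ?q. \<epsilon> * (Sup K - Inf K))"
    proof (rule sum_mono)
      fix i assume "i \<in> p - ?q"
      then obtain x K where i: "i = (x, K)" and x: "(x, K) \<in> p" "x \<notin> N" by (cases i) auto
      obtain u v where K: "K = {u..v}" "u \<le> v" "x \<in> {u..v}" "{u..v} \<subseteq> {a..b}" "{u..v} \<subseteq> ball x (r x)"
        using pD[OF x(1)] by blast
      have "u \<in> {u..v}" "v \<in> {u..v}" using K(2) by auto
      then have "u \<in> {a..b}" "v \<in> {a..b}" "x \<in> {a..b}" "u \<in> ball x (r x)" "v \<in> ball x (r x)"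
        using K(3-5) by blast+
      moreover from this have "\<bar>u - x\<bar> < r x" "\<bar>v - x\<bar> < r x" by (auto simp: dist_real_def)
      ultimately have "\<bar>w u - w x\<bar> \<le> \<epsilon> * \<bar>u - x\<bar>" "\<bar>w v - w x\<bar> \<le> \<epsilon> * \<bar>v - x\<bar>"
        using rw[of x u] rw[of x v] x(2) by blast+
      moreover have "\<epsilon> * \<bar>u - x\<bar> + \<epsilon> * \<bar>v - x\<bar> = \<epsilon> * (v - u)" using K(3) by (auto simp: algebra_simps)
      ultimately show "(case i of (x, K) \<Rightarrow> \<bar>w (Sup K) - w (Inf K)\<bar>)
          \<le> (case i of (x, K) \<Rightarrow> \<epsilon> * (Sup K - Inf K))"
        using K(1,2) by (simp add: i)
    qed
    also have "\<dots> \<le> (\<Sum>(x, K)\<in>p. \<epsilon> * (Sup K - Inf K))"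
    proof (rule sum_mono2[OF fin])
      fix i assume "i \<in> p - (p - ?q)"
      then show "0 \<le> (case i of (x, K) \<Rightarrow> \<epsilon> * (Sup K - Inf K))"
        using pD \<open>\<epsilon> > 0\<close> by (cases i) fastforce
    qed auto
    also have "\<dots> = \<epsilon> * (b - a)"
      using additive_tagged_division_1[OF ab p(1), of "\<lambda>x. x"]
      by (simp add: sum_distrib_left[symmetric] case_prod_unfold)
    also have "(\<Sum>(x, K)\<in>?q. \<bar>w (Sup K) - w (Inf K)\<bar>) \<le> \<epsilon>"
    proof -
      define e where "e = (\<lambda>(x::real, K::real set). (Inf K, Sup K))"
      have e_eq: "\<exists>u v. K = {u..v} \<and> e (x, K) = (u, v) \<and> u \<le> v" if "(x, K) \<in> p" for x K
        using pD[OF that] by (auto simp: e_def)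
      define P where "P = e ` ?q"
      have PD: "\<exists>x. x \<in> N \<and> (x, {u..v}) \<in> p \<and> u \<le> v" if "(u, v) \<in> P" for u v
        using that e_eq unfolding P_def by fastforce
      have "finite P" using fin by (simp add: P_def)
      moreover have P1: "u \<le> v \<and> {u..v} \<subseteq> {a..b}" if "(u, v) \<in> P" for u v
        using PD[OF that] p(1) by blast
      moreover have disj: "disjoint_family_on (\<lambda>(x, y). {x<..<y}) P"
        unfolding disjoint_family_on_def
      proof (intro ballI impI)
        fix i j assume ij: "i \<in> P" "j \<in> P" "i \<noteq> j"
        obtain u v u' v' where eq: "i = (u, v)" "j = (u', v')" by fastforce
        have *: "(u, v) \<in> P" "(u', v') \<in> P" "(u, v) \<noteq> (u', v')" using ij eq by auto
        obtain x x' where x: "(x, {u..v}) \<in> p" "(x', {u'..v'}) \<in> p" "u \<le> v" "u' \<le> v'"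
          using PD *(1,2) by blast
        have "{u..v} \<noteq> {u'..v'}" using *(3) x(3,4) by (auto simp: Icc_eq_Icc)
        then have "interior {u..v} \<inter> interior {u'..v'} = {}"
          using tagged_division_ofD(5)[OF p(1) x(1,2)] by simp
        then show "(case i of (x, y) \<Rightarrow> {x<..<y}) \<inter> (case j of (x, y) \<Rightarrow> {x<..<y}) = {}"
          by (simp add: eq)
      qed
      moreover have "(\<Sum>(x, y)\<in>P. y - x) < \<delta>"
      proof -
        have "(\<Sum>(x, y)\<in>P. y - x) = (\<Sum>i\<in>P. measure lebesgue (case i of (x, y) \<Rightarrow> {x<..<y}))"
          by (rule sum.cong) (use P1 in auto)
        also have "\<dots> = measure lebesgue (\<Union>i\<in>P. case i of (x, y) \<Rightarrow> {x<..<y})"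
          using disj \<open>finite P\<close>
          by (intro measure_negligible_finite_Union_image[symmetric])
             (auto simp: pairwise_def disjoint_family_on_def)
        also have "\<dots> \<le> measure lebesgue U"
        proof (rule measure_mono_fmeasurable[OF _ _ U(3)])
          show "(\<Union>i\<in>P. case i of (x, y) \<Rightarrow> {x<..<y}) \<subseteq> U"
          proof clarify
            fix z u v assume "(u, v) \<in> P" "z \<in> {u<..<v}"
            moreover from this(1) obtain x where "x \<in> N" "(x, {u..v}) \<in> p" using PD by blast
            moreover from this(2) have "{u..v} \<subseteq> ball x (r x)" using p(2) by (auto simp: fine_def)
            moreover have "z \<in> {u..v}" using \<open>z \<in> {u<..<v}\<close> by simp
            ultimately show "z \<in> U" using r(2)[of x] by blast
          qed
          show "(\<Union>i\<in>P. case i of (x, y) \<Rightarrow> {x<..<y}) \<in> sets lebesgue"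
            using \<open>finite P\<close> by (intro sets.finite_UN) auto
        qed
        finally show ?thesis using U(4) by simp
      qed
      ultimately have "(\<Sum>(x, y)\<in>P. \<bar>w y - w x\<bar>) < \<epsilon>" by (rule \<delta>)
      also have "(\<Sum>(x, y)\<in>P. \<bar>w y - w x\<bar>) = (\<Sum>(x, K)\<in>?q. \<bar>w (Sup K) - w (Inf K)\<bar>)"
        unfolding P_def
      \<comment> \<open>Passing from tagged intervals to end points can only identify degenerate intervals, which contribute nothing.\<close>
      proof (subst sum.reindex_nontrivial)
        fix i j assume ij: "i \<in> ?q" "j \<in> ?q" "i \<noteq> j" "e i = e j"
        obtain x K x' K' where i: "i = (x, K)" "j = (x', K')" by fastforce
        obtain u v where K: "K = {u..v}" "e i = (u, v)" "u \<le> v" using e_eq ij i by blast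
        obtain u' v' where K': "K' = {u'..v'}" "e j = (u', v')" "u' \<le> v'" using e_eq ij i by blast
        have "K = K'" using K K' ij(4) by simp
        then have "interior K = {}"
          using tagged_division_ofD(5)[OF p(1), of x K x' K'] ij i by auto
        then have "u = v" using K(1,3) by simp
        then show "(case e i of (x, y) \<Rightarrow> \<bar>w y - w x\<bar>) = 0" using K(2) by simp
      qed (use fin in \<open>auto simp: e_def case_prod_unfold\<close>)
      finally show ?thesis by simp
    qed
    finally have "(\<Sum>(x, K)\<in>p. \<bar>w (Sup K) - w (Inf K)\<bar>) \<le> \<epsilon> * (b - a + 1)"
      by (simp add: algebra_simps)
    moreover have "\<bar>\<Sum>(x, K)\<in>p. w (Sup K) - w (Inf K)\<bar> \<le> (\<Sum>(x, K)\<in>p. \<bar>w (Sup K) - w (Inf K)\<bar>)"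
      by (rule order_trans[OF sum_abs]) (simp add: case_prod_unfold)
    ultimately show ?thesis
      using additive_tagged_division_1[OF ab p(1), of w] by simp
  qed
  have "\<bar>w b - w a\<bar> \<le> 0 + e" if "e > 0" for e
    using bound[of "e / (b - a + 1)"] that ab by simp
  then have "\<bar>w b - w a\<bar> \<le> 0" by (rule field_le_epsilon)
  then show ?thesis by simp
qed

lemma absolutely_continuous_on_subset:
  assumes "absolutely_continuous_on S f" "T \<subseteq> S"
  shows "absolutely_continuous_on T f"
proof -
  have *: "\<forall>(x, y)\<in>P. x \<le> y \<and> {x..y} \<subseteq> S" if "\<forall>(x, y)\<in>P. x \<le> y \<and> {x..y} \<subseteq> T" for P
    using that assms(2) by blast
  show ?thesis
    unfolding absolutely_continuous_on_def
  proof (intro allI impI)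
    fix \<epsilon> :: real assume "\<epsilon> > 0"
    then obtain \<delta> where "\<delta> > 0" and \<delta>: "\<forall>P. finite P \<longrightarrow>
      (\<forall>(x, y)\<in>P. x \<le> y \<and> {x..y} \<subseteq> S) \<longrightarrow>
      disjoint_family_on (\<lambda>(x, y). {x<..<y}) P \<longrightarrow>
      (\<Sum>(x, y)\<in>P. y - x) < \<delta> \<longrightarrow>
      (\<Sum>(x, y)\<in>P. \<bar>f y - f x\<bar>) < \<epsilon>"
      using assms(1) unfolding absolutely_continuous_on_def by meson
    show "\<exists>\<delta>>0. \<forall>P. finite P \<longrightarrow> (\<forall>(x, y)\<in>P. x \<le> y \<and> {x..y} \<subseteq> T) \<longrightarrow>
      disjoint_family_on (\<lambda>(x, y). {x<..<y}) P \<longrightarrow> (\<Sum>(x, y)\<in>P. y - x) < \<delta> \<longrightarrow>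
      (\<Sum>(x, y)\<in>P. \<bar>f y - f x\<bar>) < \<epsilon>"
      by (rule exI[of _ \<delta>]) (use \<open>\<delta> > 0\<close> \<delta> * in presburger)
  qed
qed

lemma has_real_derivative_eq_on:
  fixes f :: "real \<Rightarrow> real"
  assumes "t \<in> S" "\<And>x. x \<in> S \<Longrightarrow> f x = g x" "(f has_real_derivative d) (at t within S)"
  shows "(g has_real_derivative d) (at t within S)"
  using has_derivative_transform[of t S g f] assms unfolding has_field_derivative_def by auto

text \<open>The pairs \<open>(w, g)\<close> with \<open>w(t) = w(0) + \<integral>\<^sub>0\<^sup>t g\<close>, in the form in which second derivatives occur in the
  boundary value problems. Keeping the almost-everywhere derivative as a parameter makes this a small
  differential calculus: the null sets never show up in the computations.\<close>

definition AC_deriv :: "(real \<Rightarrow> real) \<Rightarrow> (real \<Rightarrow> real) \<Rightarrow> bool" where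
  "AC_deriv w g \<longleftrightarrow> absolutely_continuous_on I w \<and>
    (AE t\<in>I in lebesgue. (w has_real_derivative g t) (at t within I))"

lemma AC_deriv_imp_continuous: "AC_deriv w g \<Longrightarrow> continuous_on I w"
  by (simp add: AC_deriv_def absolutely_continuous_on_Icc_imp_continuous)

lemma AC_deriv_add:
  "\<lbrakk>AC_deriv v f; AC_deriv w g\<rbrakk> \<Longrightarrow> AC_deriv (\<lambda>t. v t + w t) (\<lambda>t. f t + g t)"
  unfolding AC_deriv_def
  by (auto intro: absolutely_continuous_on_add DERIV_add elim!: eventually_elim2)

lemma AC_deriv_mult:
  "\<lbrakk>AC_deriv v f; AC_deriv w g\<rbrakk> \<Longrightarrow> AC_deriv (\<lambda>t. v t * w t) (\<lambda>t. f t * w t + g t * v t)"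
  unfolding AC_deriv_def
  by (auto intro: absolutely_continuous_on_Icc_mult DERIV_mult elim!: eventually_elim2)

lemma AC_deriv_cong:
  assumes "AC_deriv v f" "\<And>t. t \<in> I \<Longrightarrow> v t = w t" "\<And>t. t \<in> I \<Longrightarrow> f t = g t"
  shows "AC_deriv w g"
proof -
  have "(w has_real_derivative g t) (at t within I)"
    if "t \<in> I" "(v has_real_derivative f t) (at t within I)" for t
    using has_real_derivative_eq_on[OF that(1) _ that(2), of w] assms that by auto
  moreover have "AE t\<in>I in lebesgue. (v has_real_derivative f t) (at t within I)"
    using assms(1) by (simp add: AC_deriv_def)
  ultimately show ?thesis
    using assms absolutely_continuous_on_cong[of I v w]
    unfolding AC_deriv_def by (auto elim!: eventually_mono)
qed

lemma AC_deriv_C1: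
  assumes d: "\<And>t. t \<in> I \<Longrightarrow> (w has_real_derivative g t) (at t within I)"
    and g: "continuous_on I g"
  shows "AC_deriv w g"
proof -
  have "bounded (g ` I)" by (intro compact_imp_bounded compact_continuous_image g) simp
  then obtain B where "\<forall>t\<in>I. norm (g t) \<le> B" unfolding bounded_iff by auto
  then have B: "norm (g t) \<le> B" if "t \<in> I" for t using that by blast
  have "norm (w y - w x) \<le> B * norm (y - x)" if "x \<in> I" "y \<in> I" for x y
    by (rule field_differentiable_bound[OF _ d B that(2,1)]) auto
  then have "absolutely_continuous_on I w"
    by (intro absolutely_continuous_on_Lipschitz[of _ _ B]) auto
  then show ?thesis using d by (simp add: AC_deriv_def)
qed

lemma AC_deriv_const: "AC_deriv (\<lambda>t. c) (\<lambda>t. 0)"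
  by (rule AC_deriv_C1) auto

lemma AC_deriv_cmult: "AC_deriv w g \<Longrightarrow> AC_deriv (\<lambda>t. c * w t) (\<lambda>t. c * g t)"
  by (rule AC_deriv_cong[OF AC_deriv_mult[OF AC_deriv_const[of c], of w g]]) auto

lemma AC_deriv_diff:
  "\<lbrakk>AC_deriv v f; AC_deriv w g\<rbrakk> \<Longrightarrow> AC_deriv (\<lambda>t. v t - w t) (\<lambda>t. f t - g t)"
  using AC_deriv_add[OF _ AC_deriv_cmult[of w g "-1"], of v f] by simp

lemma AC_deriv_integral:
  assumes "f absolutely_integrable_on I"
  shows "AC_deriv (\<lambda>t. integral {0..t} f) f"
  unfolding AC_deriv_def
  using absolutely_continuous_on_integral[OF assms] lebesgue_differentiation[of f 0 1] assms
  by (auto simp: absolutely_integrable_on_def)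

lemma AC_deriv_zero_const:
  assumes w: "AC_deriv w (\<lambda>t. 0)" and t: "t \<in> I"
  shows "w t = w 0"
proof (rule absolutely_continuous_derivative_zero_imp_eq[of 0 t w])
  have sub: "{0..t} \<subseteq> I" using t by auto
  show "absolutely_continuous_on {0..t} w"
    using w sub by (auto simp: AC_deriv_def intro: absolutely_continuous_on_subset)
  have "AE u\<in>I in lebesgue. (w has_real_derivative 0) (at u within I)"
    using w by (simp add: AC_deriv_def)
  then show "AE u\<in>{0..t} in lebesgue. (w has_real_derivative 0) (at u within {0..t})"
    by eventually_elim (use sub in \<open>auto intro: DERIV_subset\<close>)
qed (use t in auto)

text \<open>An absolutely continuous function differs by a constant from the integral of its derivative; if
  that derivative is continuous, the exceptional points disappear. This is how solutions
  built from integrals are recognised as continuously differentiable.\<close>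

lemma AC_deriv_continuous_imp_C1:
  assumes w: "AC_deriv w g" and g: "continuous_on I g" and t: "t \<in> I"
  shows "(w has_real_derivative g t) (at t within I)"
proof -
  define G where "G = (\<lambda>t. integral {0..t} g)"
  have G: "(G has_real_derivative g u) (at u within I)" if "u \<in> I" for u
    unfolding G_def using integral_has_real_derivative[OF g that] .
  then have "AC_deriv G g" using g by (rule AC_deriv_C1)
  then have "AC_deriv (\<lambda>t. w t - G t) (\<lambda>t. 0)"
    using AC_deriv_diff[OF w] by fastforce
  then have "w u - G u = w 0 - G 0" if "u \<in> I" for u
    using AC_deriv_zero_const that by blast
  then have eq: "G u + (w 0 - G 0) = w u" if "u \<in> I" for u
    using that by (simp add: algebra_simps)
  have "((\<lambda>u. G u + (w 0 - G 0)) has_real_derivative g t) (at t within I)"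
    by (auto intro!: derivative_eq_intros G t)
  then show ?thesis
    by (rule has_real_derivative_eq_on[OF t eq, rotated])
qed

section \<open>Linear initial value problems with continuous coefficients\<close>

lemma nonneg_derivative_on_I_imp_mono:
  fixes f :: "real \<Rightarrow> real"
  assumes d: "\<And>t. t \<in> I \<Longrightarrow> (f has_real_derivative f' t) (at t within I)"
    and nonneg: "\<And>t. t \<in> I \<Longrightarrow> s < t \<Longrightarrow> t < u \<Longrightarrow> f' t \<ge> 0"
    and su: "s \<in> I" "u \<in> I" "s \<le> u"
  shows "f s \<le> f u"
proof (rule DERIV_nonneg_imp_increasing_open[OF su(3)])
  fix t assume t: "s < t" "t < u"
  then have "t \<in> interior I" using su by simp
  then have "at t within I = at t" by (rule at_within_interior)
  moreover have "t \<in> I" using t su by auto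
  ultimately show "\<exists>y. (f has_real_derivative y) (at t) \<and> 0 \<le> y"
    using d[of t] nonneg[of t] t by auto
next
  have "continuous_on I f"
    using DERIV_continuous[OF d] by (simp add: continuous_on_eq_continuous_within)
  then show "continuous_on {s..u} f" by (rule continuous_on_subset) (use su in auto)
qed

text \<open>Because the bound is on \<open>|e'|\<close>, the estimate runs both forwards and backwards in time. With \<open>b = 0\<close> it
  is used backwards for uniqueness, and with \<open>e(s) = 0\<close> forwards for dependence on the parameter.\<close>

lemma Gronwall_two_sided:
  fixes e :: "real \<Rightarrow> real"
  assumes d: "\<And>t. t \<in> I \<Longrightarrow> (e has_real_derivative e' t) (at t within I)"
    and bound: "\<And>t. t \<in> I \<Longrightarrow> \<bar>e' t\<bar> \<le> k * e t + b"
    and nonneg: "\<And>t. t \<in> I \<Longrightarrow> 0 \<le> e t" and k: "1 \<le> k" and b: "0 \<le> b"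
    and st: "s \<in> I" "t \<in> I"
  shows "e t \<le> (e s + b) * exp k"
proof -
  have bk: "b / k \<le> b" "0 \<le> b / k" "k * (b / k) = b" 
    using k b mult_left_mono[of 1 k b] by (auto simp: field_simps)
  have "(e t + b / k) \<le> (e s + b / k) * exp (k * \<bar>t - s\<bar>)"
  proof (cases "s \<le> t")
    case True
    define f where "f = (\<lambda>t. - ((e t + b / k) * exp (- k * t)))"
    have "f s \<le> f t"
    proof (rule nonneg_derivative_on_I_imp_mono[OF _ _ st True])
      show "(f has_real_derivative (k * e t + b - e' t) * exp (- k * t)) (at t within I)" if "t \<in> I" for t
        unfolding f_def by (rule derivative_eq_intros d that refl)+ (use bk(3) k in \<open>simp add: algebra_simps\<close>)
      show "0 \<le> (k * e t + b - e' t) * exp (- k * t)" if "t \<in> I" for t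
        using bound[OF that] by simp
    qed
    then have "(e t + b / k) * exp (- k * t) * exp (k * t) \<le> (e s + b / k) * exp (- k * s) * exp (k * t)"
      by (intro mult_right_mono) (auto simp: f_def)
    then show ?thesis using True by (simp add: mult.assoc exp_add[symmetric] algebra_simps)
  next
    case False
    define f where "f = (\<lambda>t. (e t + b / k) * exp (k * t))"
    have "f t \<le> f s"
    proof (rule nonneg_derivative_on_I_imp_mono[OF _ _ st(2,1)])
      show "(f has_real_derivative (k * e t + b + e' t) * exp (k * t)) (at t within I)" if "t \<in> I" for t
        unfolding f_def by (rule derivative_eq_intros d that refl)+ (use bk(3) k in \<open>simp add: algebra_simps\<close>)
      show "0 \<le> (k * e t + b + e' t) * exp (k * t)" if "t \<in> I" for t
        using bound[OF that] by simp
    qed (use False in simp)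
    then have "(e t + b / k) * exp (k * t) * exp (- k * t) \<le> (e s + b / k) * exp (k * s) * exp (- k * t)"
      by (intro mult_right_mono) (auto simp: f_def)
    then show ?thesis using False by (simp add: mult.assoc exp_add[symmetric] algebra_simps)
  qed
  also have "\<dots> \<le> (e s + b) * exp k"
    using st k bk(1,2) nonneg[OF st(1)] by (intro mult_mono) (auto simp: mult_left_le_one_le)
  finally show ?thesis using bk(2) by linarith
qed

text \<open>The Picard iteration, written as the series of its successive differences. The weight
  \<open>exp (2 K t)\<close> makes each integration gain a factor \<open>1/2\<close>, so the series converges geometrically.
  Continuity of \<open>F\<close> is asked for along continuous curves, where the iteration evaluates it.\<close>

theorem linear_ivp_solution_exists:
  fixes F :: "real \<Rightarrow> 'a::banach \<Rightarrow> 'a"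
  assumes lin: "\<And>t. t \<in> I \<Longrightarrow> linear (F t)"
    and bound: "\<And>t x. t \<in> I \<Longrightarrow> norm (F t x) \<le> K * norm x" and K: "K > 0"
    and cont: "\<And>x. continuous_on I x \<Longrightarrow> continuous_on I (\<lambda>t. F t (x t))"
  shows "\<exists>x. x 0 = x0 \<and> (\<forall>t\<in>I. (x has_vector_derivative F t (x t)) (at t within I))"
proof -
  define g where "g = rec_nat (\<lambda>t::real. x0) (\<lambda>n h t. integral {0..t} (\<lambda>s. F s (h s)))"
  have g0: "g 0 = (\<lambda>t. x0)" and gS: "g (Suc n) = (\<lambda>t. integral {0..t} (\<lambda>s. F s (g n s)))" for n
    by (simp_all add: g_def)
  define g' where "g' = (\<lambda>n t. case n of 0 \<Rightarrow> 0 | Suc m \<Rightarrow> F t (g m t))"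
  have cg: "continuous_on I (g n)" for n
  proof (induction n)
    case (Suc n)
    show ?case unfolding gS
      by (intro indefinite_integral_continuous_1 integrable_continuous_real cont Suc)
  qed (simp add: g0)
  have dg: "(g n has_vector_derivative g' n t) (at t within I)" if "t \<in> I" for n t
  proof (cases n)
    case (Suc m)
    show ?thesis unfolding Suc gS g'_def
      using integral_has_vector_derivative[OF cont[OF cg] that, of m] by simp
  qed (simp add: g0 g'_def)
  define C where "C = norm x0 * exp (2 * K)"
  have bg: "norm (g n t) \<le> norm x0 * (1/2) ^ n * exp (2 * K * t)" if "t \<in> I" for n t
    using that
  proof (induction n arbitrary: t)
    case 0
    then show ?case using K by (simp add: g0 mult_le_cancel_left1)
  next
    case (Suc n)
    let ?c = "norm x0 * (1/2) ^ n"
    have int: "((\<lambda>s. K * (?c * exp (2 * K * s))) has_integral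
        (?c * exp (2 * K * t) / 2 - ?c * exp (2 * K * 0) / 2)) {0..t}"
    proof (rule fundamental_theorem_of_calculus)
      show "((\<lambda>s. ?c * exp (2 * K * s) / 2) has_vector_derivative K * (?c * exp (2 * K * s))) (at s within {0..t})" for s
        unfolding has_real_derivative_iff_has_vector_derivative[symmetric]
        by (auto intro!: derivative_eq_intros)
    qed (use Suc in auto)
    have "norm (g (Suc n) t) \<le> integral {0..t} (\<lambda>s. K * (?c * exp (2 * K * s)))"
      unfolding gS
    proof (rule integral_norm_bound_integral)
      show "(\<lambda>s. F s (g n s)) integrable_on {0..t}"
        by (rule integrable_continuous_real, rule continuous_on_subset[OF cont[OF cg]]) (use Suc in auto)
      show "(\<lambda>s. K * (?c * exp (2 * K * s))) integrable_on {0..t}" using int by blast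
      fix s assume "s \<in> {0..t}"
      then have s: "s \<in> I" using Suc by auto
      show "norm (F s (g n s)) \<le> K * (?c * exp (2 * K * s))"
        by (rule order_trans[OF bound[OF s] mult_left_mono[OF Suc.IH[OF s]]]) (use K in simp)
    qed
    also have "\<dots> = ?c * exp (2 * K * t) / 2 - ?c * exp (2 * K * 0) / 2"
      by (rule integral_unique[OF int])
    also have "\<dots> \<le> ?c * exp (2 * K * t) / 2" by simp
    finally show ?case by simp
  qed
  have bC: "norm (g n t) \<le> C * (1/2) ^ n" if "t \<in> I" for n t
  proof -
    have "norm x0 * (1/2) ^ n * exp (2 * K * t) \<le> norm x0 * (1/2) ^ n * exp (2 * K)"
      using that K by (intro mult_left_mono) auto
    then show ?thesis using bg[OF that, of n] by (simp add: C_def mult_ac)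
  qed
  define x where "x = (\<lambda>t. \<Sum>n. g n t)"
  have summ: "summable (\<lambda>n. C * (1/2::real) ^ n)" by (intro summable_mult summable_geometric) simp
  have ul: "uniform_limit I (\<lambda>n t. \<Sum>i<n. g i t) x sequentially"
    unfolding x_def by (rule Weierstrass_m_test[OF bC summ])
  have sums: "(\<lambda>n. g n t) sums x t" if "t \<in> I" for t
    unfolding x_def by (rule summable_sums, rule summable_comparison_test'[OF summ bC[OF that]])
  have "\<exists>G. \<forall>t\<in>I. (\<lambda>n. g n t) sums (G t) \<and> (G has_derivative (\<lambda>h. h *\<^sub>R F t (x t))) (at t within I)"
  proof (rule has_derivative_series)
    show "(g n has_derivative (\<lambda>h. h *\<^sub>R g' n t)) (at t within I)" if "t \<in> I" for n t
      using dg[OF that, of n] by (simp add: has_vector_derivative_def)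
    show "(\<lambda>n. g n 0) sums x 0" by (rule sums) simp
    fix e :: real assume "e > 0"
    have "\<forall>\<^sub>F n in sequentially. \<forall>t\<in>I. dist (\<Sum>i<n. g i t) (x t) < e / K"
      using ul \<open>e > 0\<close> K by (auto simp: uniform_limit_iff)
    then have "\<forall>\<^sub>F n in sequentially. \<forall>t\<in>I. \<forall>h.
        norm ((\<Sum>i<Suc n. h *\<^sub>R g' i t) - h *\<^sub>R F t (x t)) \<le> e * norm h"
    proof eventually_elim
      case (elim n)
      show ?case
      proof (intro ballI allI)
        fix t h :: real assume t: "t \<in> I"
        interpret Ft: linear "F t" by (rule lin[OF t])
        have "(\<Sum>i<Suc n. g' i t) = F t (\<Sum>i<n. g i t)"
          by (simp add: sum.lessThan_Suc_shift g'_def Ft.sum del: sum.lessThan_Suc)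
        then have "(\<Sum>i<Suc n. h *\<^sub>R g' i t) - h *\<^sub>R F t (x t) = h *\<^sub>R F t ((\<Sum>i<n. g i t) - x t)"
          by (simp add: scaleR_right.sum[symmetric] Ft.diff scaleR_diff_right del: sum.lessThan_Suc)
        moreover have "norm (F t ((\<Sum>i<n. g i t) - x t)) \<le> K * (e / K)"
          using elim t K by (intro order_trans[OF bound[OF t]] mult_left_mono) (auto simp: dist_norm intro: less_imp_le)
        ultimately show "norm ((\<Sum>i<Suc n. h *\<^sub>R g' i t) - h *\<^sub>R F t (x t)) \<le> e * norm h"
          using K mult_left_mono[of "norm (F t ((\<Sum>i<n. g i t) - x t))" e "\<bar>h\<bar>"]
          by (simp add: mult.commute del: sum.lessThan_Suc)
      qed
    qed
    then show "\<forall>\<^sub>F n in sequentially. \<forall>t\<in>I. \<forall>h.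
        norm ((\<Sum>i<n. h *\<^sub>R g' i t) - h *\<^sub>R F t (x t)) \<le> e * norm h"
      by (rule eventually_sequentially_Suc[THEN iffD1])
  qed auto
  then obtain G where G: "\<And>t. t \<in> I \<Longrightarrow> (\<lambda>n. g n t) sums (G t)"
    "\<And>t. t \<in> I \<Longrightarrow> (G has_derivative (\<lambda>h. h *\<^sub>R F t (x t))) (at t within I)" by blast
  have Gx: "G t = x t" if "t \<in> I" for t using G(1)[OF that] sums[OF that] by (rule sums_unique2)
  have "(\<lambda>n. g n 0) sums x0"
  proof -
    have "g n 0 = (if n = 0 then x0 else 0)" for n by (cases n) (auto simp: g0 gS)
    then show ?thesis using sums_single[of 0 "\<lambda>_. x0"] by simp
  qed
  then have "G 0 = x0" using G(1)[of 0] sums_unique2 by fastforce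
  then show ?thesis
    using G(2) Gx by (auto simp: has_vector_derivative_def intro!: exI[of _ G])
qed

lemma linear_system_solution_exists:
  fixes \<alpha> \<beta> \<gamma> \<delta> :: "real \<Rightarrow> real"
  assumes c: "continuous_on I \<alpha>" "continuous_on I \<beta>" "continuous_on I \<gamma>" "continuous_on I \<delta>"
  shows "\<exists>y z. y 0 = y0 \<and> z 0 = z0 \<and> (\<forall>t\<in>I.
     (y has_real_derivative \<alpha> t * y t + \<beta> t * z t) (at t within I) \<and>
     (z has_real_derivative \<gamma> t * y t + \<delta> t * z t) (at t within I))"
proof -
  define F where "F = (\<lambda>t p. (\<alpha> t * fst p + \<beta> t * snd p, \<gamma> t * fst p + \<delta> t * snd p))"
  have "\<exists>B. \<forall>t\<in>I. \<bar>f t\<bar> \<le> B" if "continuous_on I f" for f :: "real \<Rightarrow> real"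
    using compact_imp_bounded[OF compact_continuous_image[OF that]] unfolding bounded_iff by auto
  then obtain B1 B2 B3 B4 where B: "\<forall>t\<in>I. \<bar>\<alpha> t\<bar> \<le> B1" "\<forall>t\<in>I. \<bar>\<beta> t\<bar> \<le> B2" "\<forall>t\<in>I. \<bar>\<gamma> t\<bar> \<le> B3" "\<forall>t\<in>I. \<bar>\<delta> t\<bar> \<le> B4"
    using c by meson
  define K where "K = \<bar>B1\<bar> + \<bar>B2\<bar> + \<bar>B3\<bar> + \<bar>B4\<bar> + 1"
  have "\<exists>x. x 0 = (y0, z0) \<and> (\<forall>t\<in>I. (x has_vector_derivative F t (x t)) (at t within I))"
  proof (rule linear_ivp_solution_exists)
    show "K > 0" by (simp add: K_def)
    show "linear (F t)" for t by (auto simp: F_def linear_iff algebra_simps)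
    show "continuous_on I (\<lambda>t. F t (x t))" if "continuous_on I x" for x
      unfolding F_def using that c by (auto intro!: continuous_intros)
    fix t p assume t: "t \<in> I"
    have n: "\<bar>fst p\<bar> \<le> norm p" "\<bar>snd p\<bar> \<le> norm p"
      using norm_fst_le[of "fst p" "snd p"] norm_snd_le[of "snd p" "fst p"] by auto
    have m: "\<bar>f * q\<bar> \<le> \<bar>b\<bar> * norm p" if "\<bar>f\<bar> \<le> b" "\<bar>q\<bar> \<le> norm p" for f q b :: real
      unfolding abs_mult using that by (intro mult_mono) auto
    have "norm (F t p) \<le> \<bar>fst (F t p)\<bar> + \<bar>snd (F t p)\<bar>"
      using norm_Pair_le[of "fst (F t p)" "snd (F t p)"] by simp
    also have "\<dots> \<le> \<bar>\<alpha> t * fst p\<bar> + \<bar>\<beta> t * snd p\<bar> + \<bar>\<gamma> t * fst p\<bar> + \<bar>\<delta> t * snd p\<bar>"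
      unfolding F_def by simp
    also have "\<dots> \<le> \<bar>B1\<bar> * norm p + \<bar>B2\<bar> * norm p + \<bar>B3\<bar> * norm p + \<bar>B4\<bar> * norm p"
      using B t n by (intro add_mono m) auto
    also have "\<dots> \<le> K * norm p" by (simp add: K_def algebra_simps)
    finally show "norm (F t p) \<le> K * norm p" .
  qed
  then obtain x where x: "x 0 = (y0, z0)" "\<And>t. t \<in> I \<Longrightarrow> (x has_vector_derivative F t (x t)) (at t within I)"
    by blast
  have "((\<lambda>t. fst (x t)) has_real_derivative fst (F t (x t))) (at t within I)"
       "((\<lambda>t. snd (x t)) has_real_derivative snd (F t (x t))) (at t within I)" if "t \<in> I" for t
    using bounded_linear.has_vector_derivative[OF bounded_linear_fst x(2)[OF that]]
      bounded_linear.has_vector_derivative[OF bounded_linear_snd x(2)[OF that]]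
    by (simp_all add: has_real_derivative_iff_has_vector_derivative)
  then show ?thesis
    using x(1) by (intro exI[of _ "\<lambda>t. fst (x t)"] exI[of _ "\<lambda>t. snd (x t)"]) (auto simp: F_def)
qed

section \<open>Solutions of the homogeneous equation\<close>

definition is_solution :: "(real \<Rightarrow> real) \<Rightarrow> (real \<Rightarrow> real) \<Rightarrow> (real \<Rightarrow> real) \<Rightarrow> bool" where
  "is_solution q u v \<longleftrightarrow> (\<forall>t\<in>I. (u has_real_derivative v t) (at t within I)) \<and>
     AC_deriv v (\<lambda>t. - q t * u t)"

lemma D_eqI:
  assumes "t \<in> I" "(u has_real_derivative d) (at t within I)"
  shows "D u t = d"
  using assms vector_derivative_within_closed_interval[of 0 1 t u d]
  by (simp add: D_def has_real_derivative_iff_has_vector_derivative)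

lemma has_real_derivative_D:
  assumes "u differentiable (at t within I)"
  shows "(u has_real_derivative D u t) (at t within I)"
  using assms by (simp add: D_def has_real_derivative_iff_has_vector_derivative vector_derivative_works)

lemma W21_intro:
  assumes u: "\<And>t. t \<in> I \<Longrightarrow> (u has_real_derivative v t) (at t within I)"
    and v: "AC_deriv v g"
  shows "u \<in> W21" "AE t\<in>I in lebesgue. D u differentiable (at t within I) \<and> D (D u) t = g t"
proof -
  have Du: "v t = D u t" if "t \<in> I" for t using D_eqI[OF that u[OF that]] by simp
  have "u differentiable_on I"
    unfolding differentiable_on_def real_differentiable_def using u by blast
  moreover have ac: "AC_deriv (D u) g" using AC_deriv_cong[OF v Du] by simp
  ultimately show "u \<in> W21" by (auto simp: W21_def AC_deriv_def)
  have "AE t\<in>I in lebesgue. (D u has_real_derivative g t) (at t within I)"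
    using ac by (simp add: AC_deriv_def)
  then show "AE t\<in>I in lebesgue. D u differentiable (at t within I) \<and> D (D u) t = g t"
    by eventually_elim (auto simp: real_differentiable_def intro: D_eqI)
qed

lemma is_solution_imp_solves:
  assumes "is_solution (\<lambda>t. a t + lam) u v"
  shows "u \<in> W21" "solves a lam (\<lambda>_. 0) u" "\<And>t. t \<in> I \<Longrightarrow> D u t = v t"
proof -
  have u: "\<And>t. t \<in> I \<Longrightarrow> (u has_real_derivative v t) (at t within I)"
    and v: "AC_deriv v (\<lambda>t. - (a t + lam) * u t)" using assms by (auto simp: is_solution_def)
  show "u \<in> W21" by (rule W21_intro[OF u v])
  show "D u t = v t" if "t \<in> I" for t using D_eqI[OF that u[OF that]] .
  show "solves a lam (\<lambda>_. 0) u"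
    unfolding solves_def L_def
  proof -
    have "AE t\<in>I in lebesgue. D u differentiable (at t within I) \<and> D (D u) t = - (a t + lam) * u t"
      by (rule W21_intro(2)[OF u v])
    then show "AE t\<in>I in lebesgue. D u differentiable (at t within I) \<and> D (D u) t + (a t + lam) * u t = 0"
      by eventually_elim (auto simp: algebra_simps)
  qed
qed

lemma solves_imp_is_solution:
  assumes "u \<in> W21" "solves a lam (\<lambda>_. 0) u"
  shows "is_solution (\<lambda>t. a t + lam) u (D u)"
proof -
  have "(u has_real_derivative D u t) (at t within I)" if "t \<in> I" for t
    using assms(1) that by (intro has_real_derivative_D) (auto simp: W21_def differentiable_on_def)
  moreover have "AE t\<in>I in lebesgue. (D u has_real_derivative - (a t + lam) * u t) (at t within I)"
    using assms(2) unfolding solves_def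
  proof eventually_elim
    case (elim t)
    have "D (D u) t = - (a t + lam) * u t" if "t \<in> I"
      using elim that by (simp add: L_def algebra_simps)
    then show ?case
      using elim has_real_derivative_D[of "D u" t] by metis
  qed
  ultimately show ?thesis using assms(1) by (auto simp: is_solution_def AC_deriv_def W21_def)
qed

lemma is_solution_continuous:
  assumes "is_solution q u v"
  shows "continuous_on I u" "continuous_on I v"
proof -
  show "continuous_on I u"
    using assms DERIV_continuous unfolding is_solution_def continuous_on_eq_continuous_within by blast
  show "continuous_on I v"
    using assms AC_deriv_imp_continuous unfolding is_solution_def by blast
qed

lemma wronskian_const:
  assumes 1: "is_solution q y\<^sub>1 v\<^sub>1" and 2: "is_solution q y\<^sub>2 v\<^sub>2" and t: "t \<in> I"
  shows "y\<^sub>1 t * v\<^sub>2 t - v\<^sub>1 t * y\<^sub>2 t = y\<^sub>1 0 * v\<^sub>2 0 - v\<^sub>1 0 * y\<^sub>2 0"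
proof -
  have y: "AC_deriv y\<^sub>1 v\<^sub>1" "AC_deriv y\<^sub>2 v\<^sub>2"
    using 1 2 is_solution_continuous by (auto simp: is_solution_def intro!: AC_deriv_C1)
  have v: "AC_deriv v\<^sub>1 (\<lambda>t. - q t * y\<^sub>1 t)" "AC_deriv v\<^sub>2 (\<lambda>t. - q t * y\<^sub>2 t)"
    using 1 2 by (auto simp: is_solution_def)
  have "AC_deriv (\<lambda>t. y\<^sub>1 t * v\<^sub>2 t - v\<^sub>1 t * y\<^sub>2 t) (\<lambda>t. 0)"
    by (rule AC_deriv_cong[OF AC_deriv_diff[OF AC_deriv_mult[OF y(1) v(2)] AC_deriv_mult[OF v(1) y(2)]]])
       (auto simp: algebra_simps)
  from AC_deriv_zero_const[OF this t] show ?thesis .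
qed

lemma continuous_nonzero_imp_pos:
  assumes "continuous_on I (f :: real \<Rightarrow> real)" "f 0 > 0" "\<And>t. t \<in> I \<Longrightarrow> f t \<noteq> 0" "t \<in> I"
  shows "f t > 0"
proof (rule ccontr)
  assume "\<not> f t > 0"
  then have "\<exists>x. 0 \<le> x \<and> x \<le> t \<and> f x = 0"
    using assms by (intro IVT2' continuous_on_subset[OF assms(1)]) auto
  then show False using assms(3,4) by auto
qed

text \<open>Between the bars on the left stands the derivative of \<open>y\<^sup>2 + z\<^sup>2\<close> along the first-order system satisfied by a solution
  \<open>y\<close> and its quasi-derivative \<open>z\<close>, perturbed by \<open>f\<close>; this is the input to Gronwall's inequality.\<close>

lemma quasi_derivative_energy_bound:
  fixes y z f A B lam :: real
  assumes "\<bar>A\<bar> \<le> B"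
  shows "\<bar>2 * y * (z - A * y) + 2 * z * ((- lam - A\<^sup>2) * y + A * z + f)\<bar>
     \<le> (2 + 2 * B + \<bar>lam\<bar> + B\<^sup>2) * (y\<^sup>2 + z\<^sup>2) + f\<^sup>2"
proof -
  define E where "E = y\<^sup>2 + z\<^sup>2"
  have E: "0 \<le> E" by (simp add: E_def)
  have yz: "\<bar>2 * y * z\<bar> \<le> E" "\<bar>2 * z * f\<bar> \<le> z\<^sup>2 + f\<^sup>2"
    using sum_squares_bound[of y z] sum_squares_bound[of y "-z"] sum_squares_bound[of z f] sum_squares_bound[of z "-f"]
    by (auto simp: E_def abs_le_iff)
  have A2: "\<bar>1 - lam - A\<^sup>2\<bar> \<le> 1 + \<bar>lam\<bar> + B\<^sup>2"
  proof -
    have "A\<^sup>2 \<le> B\<^sup>2" "0 \<le> A\<^sup>2" using power_mono[OF assms, of 2] by simp_all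
    then show ?thesis by (intro abs_leI) linarith+
  qed
  have "\<bar>2 * y * z * (1 - lam - A\<^sup>2)\<bar> \<le> E * (1 + \<bar>lam\<bar> + B\<^sup>2)"
    unfolding abs_mult[of "2 * y * z"] using yz(1) A2 E by (intro mult_mono) auto
  moreover have "\<bar>2 * A * (z\<^sup>2 - y\<^sup>2)\<bar> \<le> 2 * B * E"
    unfolding abs_mult[of "2 * A"] using assms E by (intro mult_mono) (auto simp: E_def abs_le_iff)
  moreover have "2 * y * (z - A * y) + 2 * z * ((- lam - A\<^sup>2) * y + A * z + f)
     = 2 * y * z * (1 - lam - A\<^sup>2) + 2 * A * (z\<^sup>2 - y\<^sup>2) + 2 * z * f"
    by (simp add: algebra_simps power2_eq_square)
  moreover have "z\<^sup>2 \<le> E" by (simp add: E_def)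
  ultimately have "\<bar>2 * y * (z - A * y) + 2 * z * ((- lam - A\<^sup>2) * y + A * z + f)\<bar>
      \<le> E * (1 + \<bar>lam\<bar> + B\<^sup>2) + 2 * B * E + E + f\<^sup>2"
    using yz(2) by linarith
  then show ?thesis unfolding E_def[symmetric] by (simp add: algebra_simps)
qed

section \<open>The Neumann initial value problem and its dependence on the parameter\<close>

locale integrable_potential =
  fixes a :: "real \<Rightarrow> real"
  assumes a: "a absolutely_integrable_on I"
begin

definition A :: "real \<Rightarrow> real" where "A t = integral {0..t} a"

lemma AC_deriv_A: "AC_deriv A a"
  unfolding A_def[abs_def] by (rule AC_deriv_integral[OF a])

lemma continuous_A: "continuous_on I A"
  by (rule AC_deriv_imp_continuous[OF AC_deriv_A])

definition B :: real where "B = (SUP t\<in>I. \<bar>A t\<bar>)"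

lemma A_bound: "t \<in> I \<Longrightarrow> \<bar>A t\<bar> \<le> B"
proof -
  have "compact ((\<lambda>t. \<bar>A t\<bar>) ` I)"
    by (intro compact_continuous_image continuous_intros continuous_A) simp
  then show "t \<in> I \<Longrightarrow> \<bar>A t\<bar> \<le> B"
    unfolding B_def by (intro cSUP_upper bounded_imp_bdd_above compact_imp_bounded)
qed

lemma B_nonneg: "0 \<le> B"
  using A_bound[of 0] by simp

text \<open>With \<open>A\<close> a primitive of \<open>a\<close>, the quasi-derivative \<open>z = y' + A y\<close> of a solution of \<open>y'' + (a + \<lambda>) y = 0\<close>
  satisfies \<open>z' = (- \<lambda> - A\<^sup>2) y + A z\<close>. Together with \<open>y' = z - A y\<close> this is a linear system whose
  coefficients are continuous although \<open>a\<close> is only integrable. The solution \<open>c\<close> below is the one with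
  \<open>c(0) = 1\<close> and \<open>c'(0) = 0\<close>, and \<open>qd\<close> is its quasi-derivative.\<close>

definition neumann_pair :: "real \<Rightarrow> (real \<Rightarrow> real) \<times> (real \<Rightarrow> real)" where
  "neumann_pair lam = (SOME (y, z). y 0 = 1 \<and> z 0 = 0 \<and> (\<forall>t\<in>I.
     (y has_real_derivative z t - A t * y t) (at t within I) \<and>
     (z has_real_derivative (- lam - (A t)\<^sup>2) * y t + A t * z t) (at t within I)))"

definition "c lam = fst (neumann_pair lam)"
definition "qd lam = snd (neumann_pair lam)"
definition "c' lam t = qd lam t - A t * c lam t"

lemma neumann_pair_properties:
  shows c_0: "c lam 0 = 1" and qd_0: "qd lam 0 = 0"
    and c_deriv: "t \<in> I \<Longrightarrow> (c lam has_real_derivative c' lam t) (at t within I)"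
    and qd_deriv: "t \<in> I \<Longrightarrow> (qd lam has_real_derivative (- lam - (A t)\<^sup>2) * c lam t + A t * qd lam t) (at t within I)"
proof -
  have "\<exists>y z. y 0 = 1 \<and> z 0 = 0 \<and> (\<forall>t\<in>I.
     (y has_real_derivative - A t * y t + 1 * z t) (at t within I) \<and>
     (z has_real_derivative (- lam - (A t)\<^sup>2) * y t + A t * z t) (at t within I))"
    by (intro linear_system_solution_exists continuous_intros continuous_A)
  then have "\<exists>p. case p of (y, z) \<Rightarrow> y 0 = 1 \<and> z 0 = 0 \<and> (\<forall>t\<in>I.
     (y has_real_derivative z t - A t * y t) (at t within I) \<and>
     (z has_real_derivative (- lam - (A t)\<^sup>2) * y t + A t * z t) (at t within I))"
    by simp
  from someI_ex[OF this] show "c lam 0 = 1" "qd lam 0 = 0"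
    "t \<in> I \<Longrightarrow> (c lam has_real_derivative c' lam t) (at t within I)"
    "t \<in> I \<Longrightarrow> (qd lam has_real_derivative (- lam - (A t)\<^sup>2) * c lam t + A t * qd lam t) (at t within I)"
    by (auto simp: c_def qd_def c'_def neumann_pair_def case_prod_unfold)
qed

lemma A_0: "A 0 = 0" by (simp add: A_def)

lemma c'_0: "c' lam 0 = 0" by (simp add: c'_def qd_0 A_0)

lemma c_is_solution: "is_solution (\<lambda>t. a t + lam) (c lam) (c' lam)"
proof -
  have cc: "continuous_on I (c lam)" "continuous_on I (qd lam)"
    using DERIV_continuous[OF c_deriv] DERIV_continuous[OF qd_deriv]
    by (simp_all add: continuous_on_eq_continuous_within)
  have "AC_deriv (qd lam) (\<lambda>t. (- lam - (A t)\<^sup>2) * c lam t + A t * qd lam t)"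
    by (intro AC_deriv_C1 qd_deriv) (auto intro!: continuous_intros continuous_A cc)
  moreover have "AC_deriv (c lam) (\<lambda>t. qd lam t - A t * c lam t)"
    by (rule AC_deriv_C1[OF c_deriv[unfolded c'_def]]) (auto intro!: continuous_intros continuous_A cc)
  ultimately have "AC_deriv (\<lambda>t. qd lam t - A t * c lam t) (\<lambda>t. - (a t + lam) * c lam t)"
    by (rule AC_deriv_cong[OF AC_deriv_diff[OF _ AC_deriv_mult[OF AC_deriv_A]]])
       (auto simp: algebra_simps power2_eq_square)
  then show ?thesis using c_deriv by (simp add: is_solution_def c'_def[abs_def])
qed

text \<open>Gronwall backwards from \<open>t\<close> would carry the zero energy back to \<open>0\<close>, where the energy is \<open>1\<close>.\<close>

lemma c_no_double_zero:
  assumes t: "t \<in> I" "c lam t = 0" "c' lam t = 0"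
  shows False
proof -
  define e where "e = (\<lambda>t. (c lam t)\<^sup>2 + (qd lam t)\<^sup>2)"
  have "e 0 \<le> (e t + 0) * exp (2 + 2 * B + \<bar>lam\<bar> + B\<^sup>2)"
  proof (rule Gronwall_two_sided[where e = e and s = t and t = 0 and b = 0 and e' = "\<lambda>t. 2 * c lam t * (qd lam t - A t * c lam t) +
      2 * qd lam t * ((- lam - (A t)\<^sup>2) * c lam t + A t * qd lam t + 0)"])
    show "(e has_real_derivative 2 * c lam t * (qd lam t - A t * c lam t) +
      2 * qd lam t * ((- lam - (A t)\<^sup>2) * c lam t + A t * qd lam t + 0)) (at t within I)" if "t \<in> I" for t
      unfolding e_def by (rule derivative_eq_intros c_deriv qd_deriv that refl)+ (simp add: c'_def)
    show "\<bar>2 * c lam t * (qd lam t - A t * c lam t) +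
      2 * qd lam t * ((- lam - (A t)\<^sup>2) * c lam t + A t * qd lam t + 0)\<bar>
      \<le> (2 + 2 * B + \<bar>lam\<bar> + B\<^sup>2) * e t + 0" if "t \<in> I" for t
      using quasi_derivative_energy_bound[OF A_bound[OF that], of "c lam t" "qd lam t" lam 0]
      by (simp add: e_def)
  qed (use t B_nonneg in \<open>auto simp: e_def\<close>)
  then show False using t by (simp add: e_def c_0 qd_0 c'_def)
qed

text \<open>The difference of two solutions satisfies the system for \<open>\<lambda>\<close> perturbed by \<open>(\<mu> - \<lambda>) c\<^sub>\<mu>\<close> and starts at
  zero, so its energy is of order \<open>(\<lambda> - \<mu>)\<^sup>2\<close>, uniformly for \<open>|\<lambda> - \<mu>| < 1\<close>.\<close>

lemma c_dependence:
  assumes "\<epsilon> > 0"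
  obtains \<delta> where "\<delta> > 0" "\<And>lam t. \<bar>lam - mu\<bar> < \<delta> \<Longrightarrow> t \<in> I \<Longrightarrow>
     \<bar>c lam t - c mu t\<bar> < \<epsilon> \<and> \<bar>c' lam t - c' mu t\<bar> < \<epsilon>"
proof -
  have "bounded (c mu ` I)"
    by (intro compact_imp_bounded compact_continuous_image is_solution_continuous(1)[OF c_is_solution]) simp
  then obtain M where M: "\<forall>t\<in>I. \<bar>c mu t\<bar> \<le> M" unfolding bounded_iff by auto
  define k where "k = 2 + 2 * B + (\<bar>mu\<bar> + 1) + B\<^sup>2"
  define C where "C = sqrt (M\<^sup>2 * exp k)"
  have main: "\<bar>c lam t - c mu t\<bar> \<le> \<bar>lam - mu\<bar> * C \<and> \<bar>qd lam t - qd mu t\<bar> \<le> \<bar>lam - mu\<bar> * C"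
    if lam: "\<bar>lam - mu\<bar> < 1" and t: "t \<in> I" for lam t
  proof -
    define y where "y = (\<lambda>t. c lam t - c mu t)"
    define x where "x = (\<lambda>t. qd lam t - qd mu t)"
    define e where "e = (\<lambda>t. (y t)\<^sup>2 + (x t)\<^sup>2)"
    define b where "b = (lam - mu)\<^sup>2 * M\<^sup>2"
    define e' where "e' = (\<lambda>t. 2 * y t * (x t - A t * y t) +
        2 * x t * ((- lam - (A t)\<^sup>2) * y t + A t * x t + (mu - lam) * c mu t))"
    have "e t \<le> (e 0 + b) * exp k"
    proof (rule Gronwall_two_sided[where e = e and s = 0 and t = t and e' = e'])
      show "(e has_real_derivative e' t) (at t within I)" if "t \<in> I" for t
        unfolding e_def e'_def y_def x_def
        by (rule derivative_eq_intros c_deriv qd_deriv that refl)+ (simp add: c'_def algebra_simps)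
      show "\<bar>e' t\<bar> \<le> k * e t + b" if "t \<in> I" for t
      proof -
        have "\<bar>e' t\<bar> \<le> (2 + 2 * B + \<bar>lam\<bar> + B\<^sup>2) * e t + ((mu - lam) * c mu t)\<^sup>2"
          unfolding e'_def e_def by (rule quasi_derivative_energy_bound[OF A_bound[OF that]])
        also have "\<dots> \<le> k * e t + b"
        proof (rule add_mono)
          show "(2 + 2 * B + \<bar>lam\<bar> + B\<^sup>2) * e t \<le> k * e t"
            using lam by (intro mult_right_mono) (auto simp: k_def e_def)
          have "(c mu t)\<^sup>2 \<le> M\<^sup>2" using M that power_mono[of "\<bar>c mu t\<bar>" M 2] by simp
          then show "((mu - lam) * c mu t)\<^sup>2 \<le> b"
            by (simp add: b_def power_mult_distrib power2_commute[of mu] mult_left_mono)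
        qed
        finally show ?thesis .
      qed
      show "1 \<le> k" using B_nonneg by (simp add: k_def)
    qed (use t in \<open>auto simp: e_def b_def\<close>)
    also have "\<dots> = (\<bar>lam - mu\<bar> * C)\<^sup>2"
      by (simp add: e_def y_def x_def c_0 qd_0 b_def C_def power_mult_distrib)
    finally have "(y t)\<^sup>2 \<le> (\<bar>lam - mu\<bar> * C)\<^sup>2" "(x t)\<^sup>2 \<le> (\<bar>lam - mu\<bar> * C)\<^sup>2"
      using zero_le_power2[of "y t"] zero_le_power2[of "x t"] unfolding e_def by linarith+
    moreover have "0 \<le> \<bar>lam - mu\<bar> * C" by (simp add: C_def)
    ultimately show ?thesis unfolding y_def x_def
      by (intro conjI power2_le_imp_le[of "\<bar>_\<bar>"]) simp_all
  qed
  have C: "0 \<le> C" by (simp add: C_def)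
  define K where "K = C * (B + 1) + 1"
  have K: "K > 0" using C B_nonneg by (simp add: K_def add_nonneg_pos)
  show ?thesis
  proof
    show "min 1 (\<epsilon> / K) > 0" using assms K by simp
    fix lam t assume lam: "\<bar>lam - mu\<bar> < min 1 (\<epsilon> / K)" and t: "t \<in> I"
    have m: "\<bar>c lam t - c mu t\<bar> \<le> \<bar>lam - mu\<bar> * C" "\<bar>qd lam t - qd mu t\<bar> \<le> \<bar>lam - mu\<bar> * C"
      using main[of lam t] lam t by auto
    have small: "\<bar>lam - mu\<bar> * K < \<epsilon>" using lam K by (simp add: field_simps)
    have le: "\<bar>lam - mu\<bar> * C \<le> \<bar>lam - mu\<bar> * K"
      using C B_nonneg by (intro mult_left_mono) (auto simp: K_def algebra_simps)
    have "c' lam t - c' mu t = (qd lam t - qd mu t) - A t * (c lam t - c mu t)"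
      by (simp add: c'_def algebra_simps)
    also have "\<bar>\<dots>\<bar> \<le> \<bar>qd lam t - qd mu t\<bar> + \<bar>A t\<bar> * \<bar>c lam t - c mu t\<bar>"
      using abs_triangle_ineq4 by (simp add: abs_mult[symmetric])
    also have "\<dots> \<le> \<bar>lam - mu\<bar> * C + B * (\<bar>lam - mu\<bar> * C)"
      using m A_bound[OF t] B_nonneg by (intro add_mono mult_mono) auto
    also have "\<dots> \<le> \<bar>lam - mu\<bar> * K" by (simp add: K_def algebra_simps)
    finally show "\<bar>c lam t - c mu t\<bar> < \<epsilon> \<and> \<bar>c' lam t - c' mu t\<bar> < \<epsilon>"
      using m(1) le small by linarith
  qed
qed

lemma c_continuous: "continuous_on I (c lam)" "continuous_on I (c' lam)"
  using is_solution_continuous[OF c_is_solution] .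

section \<open>Parameters below the first Neumann eigenvalue\<close>

text \<open>The property that both Green's functions are built from; the aim of this section is that every
  parameter below the first Neumann eigenvalue has it.\<close>

definition subcritical :: "real \<Rightarrow> bool" where
  "subcritical lam \<longleftrightarrow> (\<forall>t\<in>I. c lam t > 0) \<and> c' lam 1 > 0"

text \<open>For very negative \<open>\<lambda>\<close> the trajectory \<open>(c, z)\<close> stays above the moving line \<open>z = \<phi> c\<close>. The height
  \<open>h = z - \<phi> c\<close> satisfies \<open>c' = h + (\<phi> - A) c\<close> and \<open>h' = \<beta> c - (\<phi> - A) h\<close> with \<open>\<beta> \<ge> 0\<close>, so
  \<open>(c h)' = h\<^sup>2 + \<beta> c\<^sup>2 \<ge> 0\<close> and neither factor can vanish.\<close>

lemma subcritical_near_minus_infinity: "\<exists>M. \<forall>lam\<le>M. subcritical lam"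
proof (intro exI allI impI)
  fix lam :: real
  assume lam: "lam \<le> - ((2 * B + 1)\<^sup>2 + (B + 2))"
  \<comment> \<open>The slope is chosen so that \<open>h(0) = 1\<close> and \<open>\<phi>(1) = B + 1 > A(1)\<close>, which makes \<open>c'(1)\<close> positive.\<close>
  define \<phi> where "\<phi> = (\<lambda>t. - 1 + (B + 2) * t)"
  define h where "h = (\<lambda>t. qd lam t - \<phi> t * c lam t)"
  define \<beta> where "\<beta> = (\<lambda>t. - lam - (A t - \<phi> t)\<^sup>2 - (B + 2))"
  have \<beta>: "\<beta> t \<ge> 0" if t: "t \<in> I" for t
  proof -
    define w where "w = (B + 2) * t"
    have "0 \<le> w" "w \<le> B + 2"
      unfolding w_def using t B_nonneg by (auto intro!: mult_left_le)
    then have "\<bar>A t - \<phi> t\<bar> \<le> 2 * B + 1"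
      using A_bound[OF t] B_nonneg unfolding \<phi>_def w_def[symmetric] by linarith
    then have "(A t - \<phi> t)\<^sup>2 \<le> (2 * B + 1)\<^sup>2"
      using power_mono[of "\<bar>A t - \<phi> t\<bar>" "2 * B + 1" 2] by simp
    then show ?thesis using lam by (simp add: \<beta>_def)
  qed
  have h_deriv: "(h has_real_derivative \<beta> t * c lam t - (\<phi> t - A t) * h t) (at t within I)" if "t \<in> I" for t
    unfolding h_def \<phi>_def
    by (rule derivative_eq_intros c_deriv qd_deriv that refl)+
       (simp add: \<beta>_def \<phi>_def c'_def algebra_simps power2_eq_square)
  have c'_eq: "c' lam t = h t + (\<phi> t - A t) * c lam t" for t
    by (simp add: c'_def h_def algebra_simps)
  have prod: "c lam 0 * h 0 \<le> c lam t * h t" if t: "t \<in> I" for t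
  proof (rule nonneg_derivative_on_I_imp_mono[where f = "\<lambda>t. c lam t * h t" and s = 0 and u = t])
    show "((\<lambda>t. c lam t * h t) has_real_derivative (h t)\<^sup>2 + \<beta> t * (c lam t)\<^sup>2) (at t within I)" if "t \<in> I" for t
      by (rule derivative_eq_intros c_deriv h_deriv that refl)+
         (simp add: c'_eq algebra_simps power2_eq_square)
    show "0 \<le> (h t)\<^sup>2 + \<beta> t * (c lam t)\<^sup>2" if "t \<in> I" for t using \<beta>[OF that] by simp
  qed (use t in auto)
  have h0: "h 0 = 1" by (simp add: h_def \<phi>_def qd_0 c_0)
  have pos: "c lam t * h t > 0" if "t \<in> I" for t using prod[OF that] by (simp add: h0 c_0)
  have c: "c lam t > 0" if "t \<in> I" for t
    by (rule continuous_nonzero_imp_pos[OF c_continuous(1) _ _ that]) (use pos c_0 in force)+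
  have "h 1 > 0" using pos[of 1] c[of 1] by (simp add: zero_less_mult_iff)
  moreover have "\<phi> 1 - A 1 > 0" using A_bound[of 1] by (simp add: \<phi>_def)
  ultimately have "c' lam 1 > 0" unfolding c'_eq using c[of 1] by (intro add_pos_pos mult_pos_pos) auto
  then show "subcritical lam" using c by (simp add: subcritical_def)
qed

text \<open>While \<open>c > 0\<close>, the quotient \<open>r = z / c\<close> solves the Riccati equation \<open>r' = - \<lambda> - (r - A)\<^sup>2\<close>, hence
  \<open>r(1) \<le> - \<lambda>\<close>; and \<open>c'(1) > 0\<close> means \<open>r(1) > A(1)\<close>.\<close>

lemma subcritical_imp_less:
  assumes "subcritical lam"
  shows "lam < - A 1"
proof -
  have c: "c lam t > 0" if "t \<in> I" for t using assms that by (simp add: subcritical_def)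
  define r where "r = (\<lambda>t. qd lam t / c lam t)"
  have r_deriv: "(r has_real_derivative - lam - (r t - A t)\<^sup>2) (at t within I)" if "t \<in> I" for t
    unfolding r_def
    by (rule derivative_eq_intros c_deriv qd_deriv that refl)+
       (use c[OF that] in \<open>simp_all add: c'_def field_simps power2_eq_square\<close>)
  have "- (r 0 + lam * 0) \<le> - (r 1 + lam * 1)"
  proof (rule nonneg_derivative_on_I_imp_mono[where f = "\<lambda>t. - (r t + lam * t)" and f' = "\<lambda>t. (r t - A t)\<^sup>2"])
    show "((\<lambda>t. - (r t + lam * t)) has_real_derivative (r t - A t)\<^sup>2) (at t within I)" if "t \<in> I" for t
      by (auto intro!: derivative_eq_intros r_deriv that)
  qed auto
  then have "r 1 \<le> - lam" by (simp add: r_def qd_0)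
  moreover have "r 1 - A 1 > 0"
    using assms by (auto simp: subcritical_def r_def c'_def field_simps)
  ultimately show ?thesis by simp
qed

lemma subcritical_open:
  assumes "subcritical mu"
  obtains \<delta> where "\<delta> > 0" "\<And>lam. \<bar>lam - mu\<bar> < \<delta> \<Longrightarrow> subcritical lam"
proof -
  obtain s where s: "s \<in> I" "\<And>t. t \<in> I \<Longrightarrow> c mu s \<le> c mu t"
    using continuous_attains_inf[OF _ _ c_continuous(1), of mu] by auto
  define \<epsilon> where "\<epsilon> = min (c mu s) (c' mu 1)"
  have "\<epsilon> > 0" using assms s(1) by (simp add: \<epsilon>_def subcritical_def)
  then obtain \<delta> where "\<delta> > 0" and \<delta>: "\<And>lam t. \<bar>lam - mu\<bar> < \<delta> \<Longrightarrow> t \<in> I \<Longrightarrow>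
     \<bar>c lam t - c mu t\<bar> < \<epsilon> \<and> \<bar>c' lam t - c' mu t\<bar> < \<epsilon>"
    using c_dependence by blast
  have "subcritical lam" if "\<bar>lam - mu\<bar> < \<delta>" for lam
    unfolding subcritical_def
  proof (intro conjI ballI)
    fix t assume "t \<in> I"
    then show "c lam t > 0" using \<delta>[OF that, of t] s(2)[of t] by (auto simp: \<epsilon>_def)
  next
    show "c' lam 1 > 0" using \<delta>[OF that, of 1] by (auto simp: \<epsilon>_def)
  qed
  then show ?thesis using that \<open>\<delta> > 0\<close> by blast
qed

text \<open>Reduction of order: if \<open>c > 0\<close>, then \<open>c\<close> and \<open>c R\<close> span all solutions.\<close>

definition R :: "real \<Rightarrow> real \<Rightarrow> real" where
  "R lam t = integral {0..t} (\<lambda>s. 1 / (c lam s)\<^sup>2)"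

lemma R_0: "R lam 0 = 0" by (simp add: R_def)

lemma R_deriv:
  assumes c: "\<And>t. t \<in> I \<Longrightarrow> c lam t > 0" and "t \<in> I"
  shows "(R lam has_real_derivative 1 / (c lam t)\<^sup>2) (at t within I)"
  unfolding R_def[abs_def]
  by (rule integral_has_real_derivative[OF _ assms(2)])
     (use c in \<open>force intro!: continuous_intros c_continuous\<close>)

lemma R_strict_mono:
  assumes c: "\<And>t. t \<in> I \<Longrightarrow> c lam t > 0" and st: "s \<in> I" "t \<in> I" "s < t"
  shows "R lam s < R lam t"
proof (rule DERIV_pos_imp_increasing_open[OF st(3)])
  have "continuous_on I (R lam)"
    using DERIV_continuous[OF R_deriv[OF c]] by (simp add: continuous_on_eq_continuous_within)
  then show "continuous_on {s..t} (R lam)" by (rule continuous_on_subset) (use st in auto)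
  fix x assume x: "s < x" "x < t"
  then have "x \<in> interior I" "x \<in> I" using st by auto
  from this(1) have "at x within I = at x" by (rule at_within_interior)
  then have "(R lam has_real_derivative 1 / (c lam x)\<^sup>2) (at x)"
    using R_deriv[OF c \<open>x \<in> I\<close>] by simp
  moreover have "0 < 1 / (c lam x)\<^sup>2" using c[OF \<open>x \<in> I\<close>] by simp
  ultimately show "\<exists>y. (R lam has_real_derivative y) (at x) \<and> 0 < y" by blast
qed

text \<open>The Wronskian of \<open>c\<close> and \<open>u\<close> is the constant \<open>u'(0)\<close>, and it equals \<open>c\<^sup>2 (u / c)'\<close>.\<close>

lemma solution_eq_c_R:
  assumes u: "is_solution (\<lambda>t. a t + lam) u v" and c: "\<And>t. t \<in> I \<Longrightarrow> c lam t > 0" and t: "t \<in> I"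
  shows "u t = c lam t * (u 0 + v 0 * R lam t)"
proof -
  have u': "(u has_real_derivative v s) (at s within I)" if "s \<in> I" for s
    using u that by (simp add: is_solution_def)
  have W: "c lam s * v s - c' lam s * u s = v 0" if "s \<in> I" for s
    using wronskian_const[OF c_is_solution u that] by (simp add: c_0 c'_0)
  define Q where "Q = (\<lambda>s. u s / c lam s - v 0 * R lam s)"
  have "(Q has_real_derivative 0) (at s within I)" if s: "s \<in> I" for s
  proof -
    have "(Q has_real_derivative (v s * c lam s - u s * c' lam s) / (c lam s * c lam s)
        - v 0 * (1 / (c lam s)\<^sup>2)) (at s within I)"
      unfolding Q_def using c[OF s]
      by (intro derivative_intros DERIV_cmult R_deriv c s u' c_deriv) auto
    moreover have "(v s * c lam s - u s * c' lam s) / (c lam s * c lam s) - v 0 * (1 / (c lam s)\<^sup>2) = 0"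
      using W[OF s] by (simp add: power2_eq_square diff_divide_distrib[symmetric] mult.commute)
    ultimately show ?thesis by simp
  qed
  then have "AC_deriv Q (\<lambda>t. 0)" by (intro AC_deriv_C1) auto
  then have "Q t = Q 0" using t by (rule AC_deriv_zero_const)
  then have "u t / c lam t = u 0 + v 0 * R lam t" by (simp add: Q_def R_0 c_0)
  then show ?thesis using c[OF t] by (simp add: field_simps)
qed

lemma subcritical_imp_nonresonant_Neumann:
  assumes "subcritical lam"
  shows "nonresonant X_N a lam"
  unfolding nonresonant_def
proof (intro ballI impI)
  fix u t assume u: "u \<in> X_N" "solves a lam (\<lambda>_. 0) u" and t: "t \<in> I"
  have sol: "is_solution (\<lambda>t. a t + lam) u (D u)"
    using u by (intro solves_imp_is_solution) (auto simp: X_N_def)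
  have D: "D u 0 = 0" "D u 1 = 0" using u by (auto simp: X_N_def)
  have eq: "u t = c lam t * u 0" if "t \<in> I" for t
    using solution_eq_c_R[OF sol _ that] assms D by (simp add: subcritical_def)
  have "c lam 1 * D u 1 - c' lam 1 * u 1 = 0"
    using wronskian_const[OF c_is_solution sol, of 1] by (simp add: c'_0 D)
  then have "u 1 = 0" using D assms by (simp add: subcritical_def)
  moreover have "c lam 1 > 0" using assms by (simp add: subcritical_def)
  ultimately have "u 0 = 0" using eq[of 1] by simp
  then show "u t = 0" using eq[OF t] by simp
qed

lemma subcritical_imp_nonresonant_Dirichlet:
  assumes "subcritical lam"
  shows "nonresonant X_D a lam"
  unfolding nonresonant_def
proof (intro ballI impI)
  fix u t assume u: "u \<in> X_D" "solves a lam (\<lambda>_. 0) u" and t: "t \<in> I"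
  have sol: "is_solution (\<lambda>t. a t + lam) u (D u)"
    using u by (intro solves_imp_is_solution) (auto simp: X_D_def)
  have D: "u 0 = 0" "u 1 = 0" using u by (auto simp: X_D_def)
  have c: "c lam t > 0" if "t \<in> I" for t using assms that by (simp add: subcritical_def)
  have eq: "u t = c lam t * (D u 0 * R lam t)" if "t \<in> I" for t
    using solution_eq_c_R[OF sol c that] D by simp
  have "D u 0 = 0"
  proof (rule ccontr)
    assume *: "D u 0 \<noteq> 0"
    have "c lam 1 * D u 1 - c' lam 1 * u 1 = D u 0"
      using wronskian_const[OF c_is_solution sol, of 1] by (simp add: c'_0 c_0)
    then show False using * eq[of 1] D c[of 1] R_strict_mono[OF c, of 0 1] by (auto simp: R_0)
  qed
  then show "u t = 0" using eq[OF t] by simp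
qed

text \<open>Let \<open>l\<close> be the infimum of the parameters that are not subcritical. By openness \<open>l\<close> is itself not
  subcritical, while by continuity \<open>c\<^sub>l \<ge> 0\<close> and \<open>c\<^sub>l'(1) \<ge> 0\<close>. A zero of \<open>c\<^sub>l\<close> would then be a double
  zero, which is impossible, so \<open>c\<^sub>l > 0\<close> and necessarily \<open>c\<^sub>l'(1) = 0\<close>: \<open>c\<^sub>l\<close> is a Neumann eigenfunction.
  Subcritical parameters are nonresonant, so \<open>l\<close> is the least eigenvalue. In particular this shows
  that a least eigenvalue exists.\<close>

theorem less_first_Neumann_eigenvalue_imp_subcritical:
  assumes "lam < first_eigenvalue X_N a"
  shows "subcritical lam"
proof -
  define S where "S = {lam. \<not> subcritical lam}"
  define l where "l = Inf S"
  have "- A 1 \<in> S" using subcritical_imp_less[of "- A 1"] by (auto simp: S_def)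
  obtain M where M: "\<And>lam. lam \<le> M \<Longrightarrow> subcritical lam" using subcritical_near_minus_infinity by blast
  have bdd: "bdd_below S"
  proof (rule bdd_belowI)
    show "M \<le> lam" if "lam \<in> S" for lam
      using that M[of lam] by (auto simp: S_def intro: ccontr)
  qed
  have below: "subcritical lam" if "lam < l" for lam
    using that cInf_lower[OF _ bdd, of lam] by (auto simp: S_def l_def)
  have l: "\<not> subcritical l"
  proof
    assume "subcritical l"
    then obtain \<delta> where "\<delta> > 0" "\<And>lam. \<bar>lam - l\<bar> < \<delta> \<Longrightarrow> subcritical lam"
      using subcritical_open by blast
    then have "\<not> \<bar>lam - l\<bar> < \<delta>" "\<not> lam < l" if "lam \<in> S" for lam
      using that below[of lam] by (auto simp: S_def)
    then have "l + \<delta> \<le> lam" if "lam \<in> S" for lam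
      using that by fastforce
    then have "l + \<delta> \<le> l" unfolding l_def using \<open>- A 1 \<in> S\<close> by (intro cInf_greatest) auto
    then show False using \<open>\<delta> > 0\<close> by simp
  qed
  have lim: "c l t \<ge> 0" "c' l 1 \<ge> 0" if "t \<in> I" for t
  proof -
    show "c l t \<ge> 0"
    proof (rule ccontr)
      assume "\<not> c l t \<ge> 0"
      then obtain \<delta> where "\<delta> > 0" and \<delta>: "\<And>lam t'. \<bar>lam - l\<bar> < \<delta> \<Longrightarrow> t' \<in> I \<Longrightarrow>
         \<bar>c lam t' - c l t'\<bar> < - c l t \<and> \<bar>c' lam t' - c' l t'\<bar> < - c l t"
        using c_dependence[of "- c l t" l] by (metis neg_0_less_iff_less not_le)
      then have "\<bar>c (l - \<delta> / 2) t - c l t\<bar> < - c l t" using \<delta>[of "l - \<delta> / 2" t] that by simp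
      moreover have "c (l - \<delta> / 2) t > 0"
        using below[of "l - \<delta> / 2"] \<open>\<delta> > 0\<close> that by (simp add: subcritical_def)
      ultimately show False by linarith
    qed
    show "c' l 1 \<ge> 0"
    proof (rule ccontr)
      assume "\<not> c' l 1 \<ge> 0"
      then obtain \<delta> where "\<delta> > 0" and \<delta>: "\<And>lam t'. \<bar>lam - l\<bar> < \<delta> \<Longrightarrow> t' \<in> I \<Longrightarrow>
         \<bar>c lam t' - c l t'\<bar> < - c' l 1 \<and> \<bar>c' lam t' - c' l t'\<bar> < - c' l 1"
        using c_dependence[of "- c' l 1" l] by (metis neg_0_less_iff_less not_le)
      then have "\<bar>c' (l - \<delta> / 2) 1 - c' l 1\<bar> < - c' l 1" using \<delta>[of "l - \<delta> / 2" 1] by simp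
      moreover have "c' (l - \<delta> / 2) 1 > 0"
        using below[of "l - \<delta> / 2"] \<open>\<delta> > 0\<close> by (simp add: subcritical_def)
      ultimately show False by linarith
    qed
  qed
  have nz: "c l t \<noteq> 0" if t: "t \<in> I" for t
  proof
    assume 0: "c l t = 0"
    \<comment> \<open>One-sided difference quotients at the minimum \<open>t\<close> force \<open>c\<^sub>l'(t) = 0\<close>; at \<open>t = 1\<close> the right-hand one is replaced by \<open>c\<^sub>l'(1) \<ge> 0\<close>.\<close>
    then have t0: "t > 0" using t c_0[of l] by (cases "t = 0") auto
    have le: "c' l t \<le> 0"
    proof (rule ccontr)
      assume "\<not> c' l t \<le> 0"
      then obtain d where "d > 0" "\<And>h. \<lbrakk>h > 0; t - h \<in> I; h < d\<rbrakk> \<Longrightarrow> c l (t - h) < c l t"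
        using has_real_derivative_pos_inc_left[OF c_deriv[OF t]] by (metis not_le)
      from this(2)[of "min (d / 2) t"] \<open>d > 0\<close> t0 t have "c l (t - min (d / 2) t) < 0"
        by (simp add: 0 min_def)
      moreover have "t - min (d / 2) t \<in> I" using \<open>d > 0\<close> t t0 by auto
      ultimately show False using lim(1) by (meson not_le)
    qed
    have ge: "c' l t \<ge> 0"
    proof (cases "t = 1")
      case True then show ?thesis using lim(2)[OF t] by simp
    next
      case False
      then have t1: "t < 1" using t by auto
      show ?thesis
      proof (rule ccontr)
        assume "\<not> c' l t \<ge> 0"
        then obtain d where "d > 0" "\<And>h. \<lbrakk>h > 0; t + h \<in> I; h < d\<rbrakk> \<Longrightarrow> c l (t + h) < c l t"
          using has_real_derivative_neg_dec_right[OF c_deriv[OF t]] by (metis not_le)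
        from this(2)[of "min (d / 2) (1 - t)"] \<open>d > 0\<close> t1 t have "c l (t + min (d / 2) (1 - t)) < 0"
          by (simp add: 0 min_def)
        moreover have "t + min (d / 2) (1 - t) \<in> I" using \<open>d > 0\<close> t t1 by auto
        ultimately show False using lim(1) by (meson not_le)
      qed
    qed
    show False using c_no_double_zero[OF t 0] le ge by simp
  qed
  have c'1: "c' l 1 = 0"
  proof -
    have "c l t > 0" if "t \<in> I" for t using lim(1)[OF that] nz[OF that] by simp
    then show ?thesis using l lim(2)[of 0] by (auto simp: subcritical_def)
  qed
  have "eigenvalue X_N a l"
    unfolding eigenvalue_def
  proof (intro bexI[of _ "c l"] conjI)
    show "c l \<in> X_N"
      using is_solution_imp_solves[OF c_is_solution] c'1 by (auto simp: X_N_def c'_0)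
    show "solves a l (\<lambda>_. 0) (c l)" by (rule is_solution_imp_solves[OF c_is_solution])
    show "\<exists>t\<in>I. c l t \<noteq> 0" using c_0[of l] by (intro bexI[of _ 0]) auto
  qed
  moreover have "l \<le> mu" if "eigenvalue X_N a mu" for mu
  proof (rule ccontr)
    assume "\<not> l \<le> mu"
    then have "nonresonant X_N a mu" by (intro subcritical_imp_nonresonant_Neumann below) simp
    then show False using that by (auto simp: eigenvalue_def nonresonant_def)
  qed
  ultimately have "first_eigenvalue X_N a = l"
    unfolding first_eigenvalue_def by (rule Least_equality)
  then show ?thesis using assms below by simp
qed

end

section \<open>Green's functions glued from two solutions\<close>

lemma continuous_times_absolutely_integrable:
  fixes f g :: "real \<Rightarrow> real"
  assumes "continuous_on I f" "g absolutely_integrable_on I"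
  shows "(\<lambda>s. f s * g s) absolutely_integrable_on I"
proof (rule absolutely_integrable_bounded_measurable_product_real)
  show "f \<in> borel_measurable (lebesgue_on I)"
    by (rule continuous_imp_measurable_on_sets_lebesgue[OF assms(1)]) simp
  show "bounded (f ` I)"
    by (intro compact_imp_bounded compact_continuous_image assms(1)) simp
qed (use assms(2) in auto)

lemma glued_kernel_integral:
  fixes y\<^sub>1 y\<^sub>2 \<sigma> :: "real \<Rightarrow> real"
  assumes c: "continuous_on I y\<^sub>1" "continuous_on I y\<^sub>2" and \<sigma>: "\<sigma> absolutely_integrable_on I"
    and G: "\<And>t s. t \<in> I \<Longrightarrow> s \<in> I \<Longrightarrow> G (t, s) = y\<^sub>1 (min t s) * y\<^sub>2 (max t s) / w"
    and t: "t \<in> I"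
  shows "(LINT s:I|lebesgue. G (t, s) * \<sigma> s) =
     1 / w * (y\<^sub>2 t * integral {0..t} (\<lambda>s. y\<^sub>1 s * \<sigma> s) +
      y\<^sub>1 t * (integral I (\<lambda>s. y\<^sub>2 s * \<sigma> s) - integral {0..t} (\<lambda>s. y\<^sub>2 s * \<sigma> s)))"
proof -
  have y: "(\<lambda>s. y\<^sub>1 s * \<sigma> s) integrable_on I" "(\<lambda>s. y\<^sub>2 s * \<sigma> s) integrable_on I"
    using continuous_times_absolutely_integrable[OF _ \<sigma>] c by (auto simp: absolutely_integrable_on_def)
  have "continuous_on I (\<lambda>s. y\<^sub>1 (min t s) * y\<^sub>2 (max t s) * (1 / w))"
    by (intro continuous_intros continuous_on_compose2[OF c(1)] continuous_on_compose2[OF c(2)]) (use t in auto)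
  then have "continuous_on I (\<lambda>s. G (t, s))"
    by (rule continuous_on_eq) (use G t in auto)
  then have "(\<lambda>s. G (t, s) * \<sigma> s) absolutely_integrable_on I"
    by (rule continuous_times_absolutely_integrable[OF _ \<sigma>])
  then have L: "(LINT s:I|lebesgue. G (t, s) * \<sigma> s) = integral I (\<lambda>s. G (t, s) * \<sigma> s)"
    and int: "(\<lambda>s. G (t, s) * \<sigma> s) integrable_on I"
    by (simp_all add: set_lebesgue_integral_eq_integral)
  have "integral I (\<lambda>s. G (t, s) * \<sigma> s) =
     integral {0..t} (\<lambda>s. G (t, s) * \<sigma> s) + integral {t..1} (\<lambda>s. G (t, s) * \<sigma> s)"
    using Henstock_Kurzweil_Integration.integral_combine[OF _ _ int, of t] t by simp
  also have "integral {0..t} (\<lambda>s. G (t, s) * \<sigma> s) = integral {0..t} (\<lambda>s. (y\<^sub>2 t / w) * (y\<^sub>1 s * \<sigma> s))"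
    by (rule Henstock_Kurzweil_Integration.integral_cong) (use t in \<open>simp add: G\<close>)
  also have "\<dots> = (y\<^sub>2 t / w) * integral {0..t} (\<lambda>s. y\<^sub>1 s * \<sigma> s)" by simp
  also have "integral {t..1} (\<lambda>s. G (t, s) * \<sigma> s) = integral {t..1} (\<lambda>s. (y\<^sub>1 t / w) * (y\<^sub>2 s * \<sigma> s))"
    by (rule Henstock_Kurzweil_Integration.integral_cong) (use t in \<open>simp add: G\<close>)
  also have "\<dots> = (y\<^sub>1 t / w) * integral {t..1} (\<lambda>s. y\<^sub>2 s * \<sigma> s)" by simp
  also have "integral {t..1} (\<lambda>s. y\<^sub>2 s * \<sigma> s) = integral I (\<lambda>s. y\<^sub>2 s * \<sigma> s) - integral {0..t} (\<lambda>s. y\<^sub>2 s * \<sigma> s)"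
    using Henstock_Kurzweil_Integration.integral_combine[OF _ _ y(2), of t] t by simp
  finally show ?thesis unfolding L by (simp add: algebra_simps add_divide_distrib diff_divide_distrib)
qed

text \<open>Variation of parameters. In \<open>u = (y\<^sub>2 F\<^sub>1 + y\<^sub>1 F\<^sub>2) / w\<close> the terms containing \<open>\<sigma>\<close> cancel in the first
  derivative and combine to \<open>\<sigma>\<close> times the Wronskian in the second. The last two conclusions say that
  \<open>u\<close> inherits the boundary condition of \<open>y\<^sub>1\<close> at \<open>0\<close> and that of \<open>y\<^sub>2\<close> at \<open>1\<close>, whatever homogeneous
  conditions these are.\<close>

lemma glued_kernel_solves:
  assumes 1: "is_solution (\<lambda>t. a t + lam) y\<^sub>1 v\<^sub>1" and 2: "is_solution (\<lambda>t. a t + lam) y\<^sub>2 v\<^sub>2"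
    and W: "\<And>t. t \<in> I \<Longrightarrow> y\<^sub>1 t * v\<^sub>2 t - v\<^sub>1 t * y\<^sub>2 t = w" and w: "w \<noteq> 0"
    and \<sigma>: "\<sigma> absolutely_integrable_on I"
    and G: "\<And>t s. t \<in> I \<Longrightarrow> s \<in> I \<Longrightarrow> G (t, s) = y\<^sub>1 (min t s) * y\<^sub>2 (max t s) / w"
  defines "u \<equiv> \<lambda>t. LINT s:I|lebesgue. G (t, s) * \<sigma> s"
  shows "u \<in> W21" "solves a lam \<sigma> u"
    "\<exists>k. u 0 = k * y\<^sub>1 0 \<and> D u 0 = k * v\<^sub>1 0" "\<exists>k. u 1 = k * y\<^sub>2 1 \<and> D u 1 = k * v\<^sub>2 1"
proof -
  note c = is_solution_continuous[OF 1] is_solution_continuous[OF 2]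
  define F\<^sub>1 where "F\<^sub>1 = (\<lambda>t. integral {0..t} (\<lambda>s. y\<^sub>1 s * \<sigma> s))"
  define F\<^sub>2 where "F\<^sub>2 = (\<lambda>t. integral I (\<lambda>s. y\<^sub>2 s * \<sigma> s) - integral {0..t} (\<lambda>s. y\<^sub>2 s * \<sigma> s))"
  define v where "v = (\<lambda>t. 1 / w * (v\<^sub>2 t * F\<^sub>1 t + v\<^sub>1 t * F\<^sub>2 t))"
  have u: "u t = 1 / w * (y\<^sub>2 t * F\<^sub>1 t + y\<^sub>1 t * F\<^sub>2 t)" if "t \<in> I" for t
    unfolding u_def F\<^sub>1_def F\<^sub>2_def by (rule glued_kernel_integral[OF c(1,3) \<sigma> G that])
  have F1: "AC_deriv F\<^sub>1 (\<lambda>t. y\<^sub>1 t * \<sigma> t)"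
    unfolding F\<^sub>1_def by (intro AC_deriv_integral continuous_times_absolutely_integrable c \<sigma>)
  have "AC_deriv F\<^sub>2 (\<lambda>t. 0 - y\<^sub>2 t * \<sigma> t)"
    unfolding F\<^sub>2_def
    by (intro AC_deriv_diff AC_deriv_const AC_deriv_integral continuous_times_absolutely_integrable c \<sigma>)
  then have F2: "AC_deriv F\<^sub>2 (\<lambda>t. - (y\<^sub>2 t * \<sigma> t))" by simp
  have y: "AC_deriv y\<^sub>1 v\<^sub>1" "AC_deriv y\<^sub>2 v\<^sub>2"
    using 1 2 c by (auto simp: is_solution_def intro!: AC_deriv_C1)
  have v12: "AC_deriv v\<^sub>1 (\<lambda>t. - (a t + lam) * y\<^sub>1 t)" "AC_deriv v\<^sub>2 (\<lambda>t. - (a t + lam) * y\<^sub>2 t)"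
    using 1 2 by (auto simp: is_solution_def)
  \<comment> \<open>\<open>F\<^sub>1\<close> and \<open>F\<^sub>2\<close> are differentiable only almost everywhere, so at first \<open>v\<close> is merely an almost-everywhere derivative; it is continuous, hence a derivative everywhere.\<close>
  have "AC_deriv (\<lambda>t. 1 / w * (y\<^sub>2 t * F\<^sub>1 t + y\<^sub>1 t * F\<^sub>2 t)) v"
    by (rule AC_deriv_cong[OF AC_deriv_cmult[where c = "1 / w", OF AC_deriv_add[OF
          AC_deriv_mult[OF y(2) F1] AC_deriv_mult[OF y(1) F2]]]])
       (auto simp: v_def algebra_simps)
  then have uAC: "AC_deriv u v"
    by (rule AC_deriv_cong) (auto simp: u)
  have v_deriv: "AC_deriv v (\<lambda>t. \<sigma> t - (a t + lam) * u t)"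
    unfolding v_def
  proof (rule AC_deriv_cong[OF AC_deriv_cmult[where c = "1 / w", OF AC_deriv_add[OF
          AC_deriv_mult[OF v12(2) F1] AC_deriv_mult[OF v12(1) F2]]] refl])
    fix t assume t: "t \<in> I"
    have "k * (- (a t + lam) * y\<^sub>2 t * F\<^sub>1 t + y\<^sub>1 t * \<sigma> t * v\<^sub>2 t +
        (- (a t + lam) * y\<^sub>1 t * F\<^sub>2 t + - (y\<^sub>2 t * \<sigma> t) * v\<^sub>1 t))
      = \<sigma> t * (k * (y\<^sub>1 t * v\<^sub>2 t - v\<^sub>1 t * y\<^sub>2 t)) - (a t + lam) * (k * (y\<^sub>2 t * F\<^sub>1 t + y\<^sub>1 t * F\<^sub>2 t))"
      for k by (simp add: algebra_simps)
    from this[of "1 / w"] have "1 / w * (- (a t + lam) * y\<^sub>2 t * F\<^sub>1 t + y\<^sub>1 t * \<sigma> t * v\<^sub>2 t +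
        (- (a t + lam) * y\<^sub>1 t * F\<^sub>2 t + - (y\<^sub>2 t * \<sigma> t) * v\<^sub>1 t))
      = \<sigma> t * (1 / w * (y\<^sub>1 t * v\<^sub>2 t - v\<^sub>1 t * y\<^sub>2 t)) - (a t + lam) * (1 / w * (y\<^sub>2 t * F\<^sub>1 t + y\<^sub>1 t * F\<^sub>2 t))" .
    also have "\<dots> = \<sigma> t - (a t + lam) * u t" using W[OF t] w by (simp add: u[OF t])
    finally show "1 / w * (- (a t + lam) * y\<^sub>2 t * F\<^sub>1 t + y\<^sub>1 t * \<sigma> t * v\<^sub>2 t +
        (- (a t + lam) * y\<^sub>1 t * F\<^sub>2 t + - (y\<^sub>2 t * \<sigma> t) * v\<^sub>1 t)) = \<sigma> t - (a t + lam) * u t" .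
  qed
  have ud: "(u has_real_derivative v t) (at t within I)" if "t \<in> I" for t
    by (rule AC_deriv_continuous_imp_C1[OF uAC AC_deriv_imp_continuous[OF v_deriv] that])
  show "u \<in> W21" by (rule W21_intro[OF ud v_deriv])
  have "AE t\<in>I in lebesgue. D u differentiable (at t within I) \<and> D (D u) t = \<sigma> t - (a t + lam) * u t"
    by (rule W21_intro(2)[OF ud v_deriv])
  then show "solves a lam \<sigma> u"
    unfolding solves_def L_def by eventually_elim auto
  have Du: "D u t = v t" if "t \<in> I" for t by (rule D_eqI[OF that ud[OF that]])
  show "\<exists>k. u 0 = k * y\<^sub>1 0 \<and> D u 0 = k * v\<^sub>1 0"
    by (rule exI[of _ "F\<^sub>2 0 / w"]) (simp add: u Du v_def F\<^sub>1_def)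
  show "\<exists>k. u 1 = k * y\<^sub>2 1 \<and> D u 1 = k * v\<^sub>2 1"
    by (rule exI[of _ "F\<^sub>1 1 / w"]) (simp add: u Du v_def F\<^sub>2_def)
qed

lemma solves_diff:
  assumes "u \<in> W21" "u' \<in> W21" "solves a lam \<sigma> u" "solves a lam \<sigma> u'"
  shows "(\<lambda>t. u t - u' t) \<in> W21" "solves a lam (\<lambda>_. 0) (\<lambda>t. u t - u' t)"
    "\<And>t. t \<in> I \<Longrightarrow> D (\<lambda>t. u t - u' t) t = D u t - D u' t"
proof -
  have d: "(u has_real_derivative D u t) (at t within I)" if "u \<in> W21" "t \<in> I" for u t
    using that by (intro has_real_derivative_D) (auto simp: W21_def differentiable_on_def)
  have DD: "AC_deriv (D u) (\<lambda>t. \<sigma> t - (a t + lam) * u t)" if "u \<in> W21" "solves a lam \<sigma> u" for u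
  proof -
    have "AE t\<in>I in lebesgue. (D u has_real_derivative \<sigma> t - (a t + lam) * u t) (at t within I)"
      using that(2) unfolding solves_def
    proof eventually_elim
      case (elim t)
      have "D (D u) t = \<sigma> t - (a t + lam) * u t" if "t \<in> I"
        using elim that by (simp add: L_def algebra_simps)
      then show ?case using elim has_real_derivative_D[of "D u" t] by metis
    qed
    then show ?thesis using that(1) by (simp add: AC_deriv_def W21_def)
  qed
  have diff: "((\<lambda>t. u t - u' t) has_real_derivative D u t - D u' t) (at t within I)" if "t \<in> I" for t
    by (intro DERIV_diff d assms that)
  have "AC_deriv (\<lambda>t. D u t - D u' t) (\<lambda>t. \<sigma> t - (a t + lam) * u t - (\<sigma> t - (a t + lam) * u' t))"
    by (intro AC_deriv_diff DD assms)
  then have "AC_deriv (\<lambda>t. D u t - D u' t) (\<lambda>t. - (a t + lam) * (u t - u' t))"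
    by (rule AC_deriv_cong) (auto simp: algebra_simps)
  then have "is_solution (\<lambda>t. a t + lam) (\<lambda>t. u t - u' t) (\<lambda>t. D u t - D u' t)"
    using diff by (simp add: is_solution_def)
  from is_solution_imp_solves[OF this]
  show "(\<lambda>t. u t - u' t) \<in> W21" "solves a lam (\<lambda>_. 0) (\<lambda>t. u t - u' t)"
    "\<And>t. t \<in> I \<Longrightarrow> D (\<lambda>t. u t - u' t) t = D u t - D u' t" by auto
qed

text \<open>Test both kernels, for fixed \<open>t\<close>, against the source \<open>\<sigma> = G(t, \<cdot>) - G'(t, \<cdot>)\<close>: by nonresonance
  the two solutions agree at \<open>t\<close>, so the integral of \<open>\<sigma>\<^sup>2\<close> vanishes.\<close>

lemma is_green_unique:
  assumes X: "X = X_D \<or> X = X_N" and G: "is_green X a lam G" and G': "is_green X a lam G'"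
  shows "G = G'"
proof (rule extensionalityI)
  show "G \<in> extensional (I \<times> I)" "G' \<in> extensional (I \<times> I)"
    using G G' by (auto simp: is_green_def)
  fix p assume "p \<in> I \<times> I"
  then obtain t s where p: "p = (t, s)" and t: "t \<in> I" and s: "s \<in> I" by auto
  have cont: "continuous_on I (\<lambda>s. H (t, s))" if "is_green X a lam H" for H
  proof -
    have "continuous_on (I \<times> I) H" using that by (simp add: is_green_def)
    moreover have "continuous_on I (\<lambda>s. (t, s))" by (intro continuous_intros)
    ultimately show ?thesis by (rule continuous_on_compose2) (use t in auto)
  qed
  define \<sigma> where "\<sigma> = (\<lambda>s. G (t, s) - G' (t, s))"
  have c\<sigma>: "continuous_on I \<sigma>" unfolding \<sigma>_def by (intro continuous_on_diff cont G G')
  then have \<sigma>: "\<sigma> absolutely_integrable_on I" by (rule absolutely_integrable_continuous_real)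
  define u where "u = (\<lambda>t. LINT s:I|lebesgue. G (t, s) * \<sigma> s)"
  define u' where "u' = (\<lambda>t. LINT s:I|lebesgue. G' (t, s) * \<sigma> s)"
  have u: "u \<in> X" "solves a lam \<sigma> u" "u' \<in> X" "solves a lam \<sigma> u'"
    using G G' \<sigma> by (auto simp: is_green_def u_def u'_def)
  then have "u \<in> W21" "u' \<in> W21" using X by (auto simp: X_D_def X_N_def)
  note diff = solves_diff[OF this u(2,4)]
  have "(\<lambda>t. u t - u' t) \<in> X"
    using X u(1,3) diff(1,3) by (auto simp: X_D_def X_N_def)
  then have "u t - u' t = 0"
    using G diff(2) t unfolding is_green_def nonresonant_def by blast
  moreover have "u t - u' t = integral I (\<lambda>s. (\<sigma> s)\<^sup>2)"
  proof -
    have H: "(\<lambda>s. H (t, s) * \<sigma> s) absolutely_integrable_on I" if "is_green X a lam H" for H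
      by (rule continuous_times_absolutely_integrable[OF cont[OF that] \<sigma>])
    then have "u t - u' t = integral I (\<lambda>s. G (t, s) * \<sigma> s) - integral I (\<lambda>s. G' (t, s) * \<sigma> s)"
      using G G' by (simp add: u_def u'_def set_lebesgue_integral_eq_integral)
    also have "\<dots> = integral I (\<lambda>s. G (t, s) * \<sigma> s - G' (t, s) * \<sigma> s)"
      using H G G' by (intro integral_diff[symmetric]) (auto simp: absolutely_integrable_on_def)
    finally show ?thesis by (simp add: \<sigma>_def power2_eq_square algebra_simps)
  qed
  ultimately have "integral I (\<lambda>s. (\<sigma> s)\<^sup>2) = 0" by simp
  then have "(\<sigma> s)\<^sup>2 = 0"
    using s by (subst (asm) integral_eq_0_iff) (auto intro!: continuous_intros c\<sigma>)
  then show "G p = G' p" by (simp add: \<sigma>_def p)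
qed

lemma green_eq:
  assumes X: "X = X_D \<and> y\<^sub>1 0 = 0 \<and> y\<^sub>2 1 = 0 \<or> X = X_N \<and> v\<^sub>1 0 = 0 \<and> v\<^sub>2 1 = 0"
    and nr: "nonresonant X a lam"
    and 1: "is_solution (\<lambda>t. a t + lam) y\<^sub>1 v\<^sub>1" and 2: "is_solution (\<lambda>t. a t + lam) y\<^sub>2 v\<^sub>2"
    and W: "\<And>t. t \<in> I \<Longrightarrow> y\<^sub>1 t * v\<^sub>2 t - v\<^sub>1 t * y\<^sub>2 t = w" and w: "w \<noteq> 0"
    and ts: "t \<in> I" "s \<in> I"
  shows "green X a lam (t, s) = y\<^sub>1 (min t s) * y\<^sub>2 (max t s) / w"
proof -
  note c = is_solution_continuous[OF 1] is_solution_continuous[OF 2]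
  define G where "G = restrict (\<lambda>(t, s). y\<^sub>1 (min t s) * y\<^sub>2 (max t s) / w) (I \<times> I)"
  have G: "G (t, s) = y\<^sub>1 (min t s) * y\<^sub>2 (max t s) / w" if "t \<in> I" "s \<in> I" for t s
    using that by (simp add: G_def)
  have "is_green X a lam G"
    unfolding is_green_def
  proof (intro conjI allI impI)
    show "G \<in> extensional (I \<times> I)" by (simp add: G_def)
    have "continuous_on (I \<times> I) (\<lambda>p. y\<^sub>1 (min (fst p) (snd p)) * y\<^sub>2 (max (fst p) (snd p)) * (1 / w))"
      by (intro continuous_intros continuous_on_compose2[OF c(1)] continuous_on_compose2[OF c(3)])
         auto
    then show "continuous_on (I \<times> I) G"
      by (rule continuous_on_eq) (auto simp: G)
    fix \<sigma> :: "real \<Rightarrow> real" assume \<sigma>: "\<sigma> absolutely_integrable_on I"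
    note * = glued_kernel_solves[where a = a and lam = lam and G = G and \<sigma> = \<sigma> and w = w
        and y\<^sub>1 = y\<^sub>1 and v\<^sub>1 = v\<^sub>1 and y\<^sub>2 = y\<^sub>2 and v\<^sub>2 = v\<^sub>2, OF 1 2 W w \<sigma> G]
    show "solves a lam \<sigma> (\<lambda>t. LINT s:I|lebesgue. G (t, s) * \<sigma> s)" by (rule *(2))
    show "(\<lambda>t. LINT s:I|lebesgue. G (t, s) * \<sigma> s) \<in> X"
      using X *(1,3,4) by (auto simp: X_D_def X_N_def)
  qed (rule nr)
  moreover have "X = X_D \<or> X = X_N" using X by auto
  ultimately have "green X a lam = G"
    unfolding green_def by (intro the_equality) (auto intro: is_green_unique)
  then show ?thesis using G ts by simp
qed

context integrable_potential
begin

section \<open>Comparison of the two Green's functions\<close>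

lemma c_R_solution:
  assumes c: "\<And>t. t \<in> I \<Longrightarrow> c lam t > 0"
  shows "is_solution (\<lambda>t. a t + lam) (\<lambda>t. c lam t * (\<alpha> + \<beta> * R lam t))
     (\<lambda>t. c' lam t * (\<alpha> + \<beta> * R lam t) + \<beta> / c lam t)"
proof -
  let ?f = "\<lambda>t. \<alpha> + \<beta> * R lam t"
  have f: "(?f has_real_derivative \<beta> / (c lam t)\<^sup>2) (at t within I)" if "t \<in> I" for t
    by (auto intro!: derivative_eq_intros R_deriv c that)
  have g: "((\<lambda>t. \<beta> / c lam t) has_real_derivative - \<beta> * c' lam t / (c lam t)\<^sup>2) (at t within I)" if "t \<in> I" for t
    by (rule derivative_eq_intros c_deriv that refl)+ (use c[OF that] in \<open>auto simp: power2_eq_square\<close>)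
  have nz: "\<forall>t\<in>I. c lam t \<noteq> 0" using c by force
  have f': "AC_deriv ?f (\<lambda>t. \<beta> / (c lam t)\<^sup>2)"
    by (rule AC_deriv_C1[OF f]) (use nz in \<open>auto intro!: continuous_intros c_continuous\<close>)
  have g': "AC_deriv (\<lambda>t. \<beta> / c lam t) (\<lambda>t. - \<beta> * c' lam t / (c lam t)\<^sup>2)"
    by (rule AC_deriv_C1[OF g]) (use nz in \<open>auto intro!: continuous_intros c_continuous\<close>)
  have c': "AC_deriv (c' lam) (\<lambda>t. - (a t + lam) * c lam t)"
    using c_is_solution by (simp add: is_solution_def)
  have "AC_deriv (\<lambda>t. c' lam t * ?f t + \<beta> / c lam t) (\<lambda>t. - (a t + lam) * (c lam t * ?f t))"
    by (rule AC_deriv_cong[OF AC_deriv_add[OF AC_deriv_mult[OF c' f'] g']]) (auto simp: algebra_simps)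
  moreover have "((\<lambda>t. c lam t * ?f t) has_real_derivative c' lam t * ?f t + \<beta> / c lam t) (at t within I)"
    if "t \<in> I" for t
    using DERIV_mult[OF c_deriv[of t lam, OF that] f[OF that]] c[OF that]
    by (simp add: power2_eq_square)
  ultimately show ?thesis by (simp add: is_solution_def)
qed

text \<open>The Dirichlet kernel is glued from \<open>c R\<close> and \<open>c (R(1) - R)\<close>, the Neumann kernel from \<open>c\<close> and
  \<open>c (\<kappa> - R)\<close>, where \<open>\<kappa> = R(1) + 1 / (c(1) c'(1))\<close> is determined by the condition at \<open>1\<close>. The
  Wronskians are \<open>- R(1)\<close> and \<open>- 1\<close>.\<close>

lemma green_comparison:
  assumes lam: "subcritical lam" and t: "t \<in> {0<..<1}" and s: "s \<in> {0<..<1}"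
  shows "G_N a lam (t, s) < G_D a lam (t, s) \<and> G_D a lam (t, s) < 0"
proof -
  have c: "\<And>t. t \<in> I \<Longrightarrow> c lam t > 0" and c'1: "c' lam 1 > 0"
    using lam by (auto simp: subcritical_def)
  define m where "m = min t s"
  define M where "M = max t s"
  have mM: "m \<in> I" "M \<in> I" "0 < m" "m < 1" "M < 1" and ts: "t \<in> I" "s \<in> I"
    using t s by (auto simp: m_def M_def)
  have R: "0 < R lam m" "R lam m < R lam 1" "R lam M < R lam 1"
    using R_strict_mono[OF c, of 0 m] R_strict_mono[OF c, of m 1] R_strict_mono[OF c, of M 1] mM
    by (auto simp: R_0)
  define \<kappa> where "\<kappa> = R lam 1 + 1 / (c lam 1 * c' lam 1)"
  have wronskian: "c lam t * (\<alpha>1 + \<beta>1 * R lam t) * (c' lam t * (\<alpha>2 + \<beta>2 * R lam t) + \<beta>2 / c lam t) -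
      (c' lam t * (\<alpha>1 + \<beta>1 * R lam t) + \<beta>1 / c lam t) * (c lam t * (\<alpha>2 + \<beta>2 * R lam t)) = \<alpha>1 * \<beta>2 - \<beta>1 * \<alpha>2"
    if "t \<in> I" for \<alpha>1 \<beta>1 \<alpha>2 \<beta>2 t
    using c[OF that] by (simp add: field_simps)
  have GD: "G_D a lam (t, s) = c lam m * (0 + 1 * R lam m) * (c lam M * (R lam 1 + - 1 * R lam M)) / (0 * - 1 - 1 * R lam 1)"
    unfolding m_def M_def
  proof (rule green_eq[OF _ _ c_R_solution[OF c] c_R_solution[OF c] wronskian _ ts])
    show "nonresonant X_D a lam" by (rule subcritical_imp_nonresonant_Dirichlet[OF lam])
  qed (use R in \<open>auto simp: R_0\<close>)
  have GN: "G_N a lam (t, s) = c lam m * (1 + 0 * R lam m) * (c lam M * (\<kappa> + - 1 * R lam M)) / (1 * - 1 - 0 * \<kappa>)"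
    unfolding m_def M_def
  proof (rule green_eq[OF _ _ c_R_solution[OF c] c_R_solution[OF c] wronskian _ ts])
    show "nonresonant X_N a lam" by (rule subcritical_imp_nonresonant_Neumann[OF lam])
    have "c lam 1 > 0" using c by simp
    then have "c' lam 1 * (\<kappa> + - 1 * R lam 1) + - 1 / c lam 1 = 0"
      using c'1 by (simp add: \<kappa>_def)
    then show "X_N = X_D \<and> c lam 0 * (1 + 0 * R lam 0) = 0 \<and> c lam 1 * (\<kappa> + - 1 * R lam 1) = 0 \<or>
       X_N = X_N \<and> c' lam 0 * (1 + 0 * R lam 0) + 0 / c lam 0 = 0 \<and>
       c' lam 1 * (\<kappa> + - 1 * R lam 1) + - 1 / c lam 1 = 0"
      by (simp add: c'_0)
  qed auto
  \<comment> \<open>Up to the common factor \<open>- p\<close> the kernels are \<open>R(m) d / R(1)\<close> and \<open>\<kappa> - R(M)\<close>; they are separated by \<open>d\<close>.\<close>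
  define p where "p = c lam m * c lam M"
  define d where "d = R lam 1 - R lam M"
  have p: "p > 0" using c mM by (simp add: p_def)
  have d: "d > 0" using R by (simp add: d_def)
  have "\<kappa> - R lam M > d" using c[of 1] c'1 by (simp add: \<kappa>_def d_def)
  moreover have "R lam m / R lam 1 * d < d" using R d by (simp add: field_simps)
  ultimately have "R lam m / R lam 1 * d < \<kappa> - R lam M" by linarith
  then have "p * (R lam m / R lam 1 * d) < p * (\<kappa> - R lam M)"
    using p by (rule mult_strict_left_mono)
  moreover have "G_D a lam (t, s) = - (p * (R lam m / R lam 1 * d))"
    unfolding GD p_def d_def by simp
  moreover have "G_N a lam (t, s) = - (p * (\<kappa> - R lam M))"
    unfolding GN p_def by simp
  moreover have "p * (R lam m / R lam 1 * d) > 0" using p d R by simp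
  ultimately show ?thesis by simp
qed

end

theorem corollary3p13:
  fixes a :: "real \<Rightarrow> real" and lam t s :: real
  assumes "a absolutely_integrable_on I"
    and "lam < first_eigenvalue X_N a"
    and "t \<in> {0<..<1}" and "s \<in> {0<..<1}"
  shows "G_N a lam (t, s) < G_D a lam (t, s) \<and> G_D a lam (t, s) < 0"
proof -
  interpret integrable_potential a by unfold_locales (rule assms(1))
  show ?thesis
    by (rule green_comparison[OF less_first_Neumann_eigenvalue_imp_subcritical[OF assms(2)] assms(3,4)])
qed

end
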